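(* Let $d\ge1$, let $\kappa:[-1,1]\to\mathbb{R}$ be given by $\kappa(t)=\sum_{q\ge 0}\frac{J_q^2}{q!}t^q$ with $J_q\in\mathbb{R}$, $J_q\neq0$ for infinitely many $q$, $\sum_{q\ge1}\frac{|J_q|}{(q-1)!}<\infty$, and $\kappa(1)=1$; let $\kappa_L$ denote the $L$-fold composition of $\kappa$. For each $L\ge1$ let $(T_L(x))_{x\in\mathbb{S}^d}$ be a continuous, isotropic, centered Gaussian random field on $\mathbb{S}^d$ with $\mathrm{Cov}(T_L(x),T_L(y))=\kappa_L(\langle x,y\rangle)$, and let $\overline{T}_L=\frac{1}{\omega_d}\int_{\mathbb{S}^d}T_L(y)\,\lambda(dy)$ be its spherical average, where $\lambda$ is the surface (Lebesgue) measure on $\mathbb{S}^d$ and $\omega_d=\lambda(\mathbb{S}^d)$. Let $m\ge1$, let $x_1,\dots,x_m\in\mathbb{S}^d$ be pairwise distinct, $\underline{x}=(x_1,\dots,x_m)$, $T_L(\underline{x})=(T_L(x_1),\dots,T_L(x_m))$, and $\boldsymbol{1}=(1,\dots,1)\in\mathbb{R}^m$. Assume $\kappa'(1)\le1$, and if $\kappa'(1)=1$ assume moreover that there exist $c\in\mathbb{R}\setminus\{0\}$ and $\rho>1$ with $1-\kappa(t)=\kappa'(1)(1-t)-c(1-t)^{\rho}+o((1-t)^{\rho})$ as $t\to1^-$. Define $v_L$ and $\mathfrak{g}$ by: \begin{itemize} \item if $\kappa'(1)<1$: $v_L=(\kappa'(1))^{-L}$ and $\mathfrak{g}(t)=\lim_{L\to\infty}(\kappa'(1))^{-L}(1-\kappa_L(t))$;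 \item if $\kappa'(1)=1$: $v_L=L^{1/(\rho-1)}$ and $\mathfrak{g}(t)=\lim_{L\to\infty}L^{1/(\rho-1)}(1-\kappa_L(t))$ \end{itemize} (these limits exist). Then the sequence $\{T_L(\underline{x})-\overline{T}_L\boldsymbol{1}\}_{L\ge1}$ satisfies a large deviation principle on $\mathbb{R}^m$ with speed $v_L$ and good rate function \[ I_{2;\mathfrak{g}}(\underline{y};\underline{x})=\sup_{\underline{\theta}\in\mathbb{R}^m}\Bigl\{\langle\underline{\theta},\underline{y}\rangle-\tfrac12\langle\underline{\theta},B_{2;\mathfrak{g}}(\underline{x})\underline{\theta}\rangle\Bigr\},\qquad\underline{y}\in\mathbb{R}^m, \] where $B_{2;\mathfrak{g}}(\underline{x})$ is the $m\times m$ matrix with entries \[ \frac{\int_{-1}^1\mathfrak{g}(t)(1-t^2)^{\frac d2-1}\,dt}{\int_{-1}^1(1-t^2)^{\frac d2-1}\,dt}-\mathfrak{g}(\langle x_i,x_j\rangle),\qquad i,j=1,\dots,m. \]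
   Context: A sequence $\{X_L\}$ of random vectors in $\mathbb{R}^m$ satisfies a large deviation principle (LDP) with speed $v_L\to\infty$ and rate function $I$ (lower semicontinuous, $[0,\infty]$-valued; good if its level sets are compact) if $\limsup_L v_L^{-1}\log P(X_L\in C)\le-\inf_C I$ for all closed $C$ and $\liminf_L v_L^{-1}\log P(X_L\in O)\ge-\inf_O I$ for all open $O$. *)

theory Defs
  imports "HOL-Probability.Probability" "HOL-Library.Landau_Symbols"
begin

definition kappa :: "(nat \<Rightarrow> real) \<Rightarrow> real \<Rightarrow> real" where
  "kappa J t = (\<Sum>q. (J q)\<^sup>2 / fact q * t ^ q)"

text \<open>Surface (Lebesgue) measure on the unit sphere of a Euclidean space of dimension n = d+1,
  defined as the cone measure: lambda(A) = n * Leb{ r x : 0 < r < 1, x in A }.\<close>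
definition sphere_surface :: "'a::euclidean_space measure" where
  "sphere_surface =
     density (distr (restrict_space lborel (ball 0 1 - {0})) (restrict_space borel (sphere 0 1))
                    (\<lambda>y. y /\<^sub>R norm y))
             (\<lambda>_. ennreal (real DIM('a)))"

definition sphere_avg :: "('a::euclidean_space \<Rightarrow> real) \<Rightarrow> real" where
  "sphere_avg f = integral\<^sup>L (sphere_surface :: 'a measure) f / measure (sphere_surface :: 'a measure) (sphere 0 1)"

text \<open>Centered Gaussian random field on S with covariance function K(x,y): all finite-dimensional
  distributions are centered Gaussian with covariance matrix (K(x_j,x_k)), expressed through
  characteristic functions.\<close>
definition centered_gaussian_field ::
  "'w measure \<Rightarrow> 'a set \<Rightarrow> ('w \<Rightarrow> 'a \<Rightarrow> real) \<Rightarrow> ('a \<Rightarrow> 'a \<Rightarrow> real) \<Rightarrow> bool" where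
  "centered_gaussian_field M S T K \<longleftrightarrow>
     (\<forall>x\<in>S. (\<lambda>\<omega>. T \<omega> x) \<in> borel_measurable M) \<and>
     (\<forall>(n::nat) (p::nat \<Rightarrow> 'a) (a::nat \<Rightarrow> real). (\<forall>k<n. p k \<in> S) \<longrightarrow>
        (LINT \<omega>|M. cis (\<Sum>k<n. a k * T \<omega> (p k)))
          = complex_of_real (exp (- (1/2) * (\<Sum>j<n. \<Sum>k<n. a j * a k * K (p j) (p k)))))"

definition eln :: "real \<Rightarrow> ereal" where
  "eln p = (if p \<le> 0 then -\<infinity> else ereal (ln p))"

text \<open>Good rate function: [0,infinity]-valued with compact (hence closed: lower semicontinuity)
  sublevel sets.\<close>
definition good_rate_function :: "('c::topological_space \<Rightarrow> ereal) \<Rightarrow> bool" where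
  "good_rate_function I \<longleftrightarrow> (\<forall>y. I y \<ge> 0) \<and> (\<forall>a::real. compact {y. I y \<le> ereal a})"

definition LDP ::
  "(nat \<Rightarrow> 'w measure) \<Rightarrow> (nat \<Rightarrow> 'w \<Rightarrow> 'c::topological_space) \<Rightarrow> (nat \<Rightarrow> real)
     \<Rightarrow> ('c \<Rightarrow> ereal) \<Rightarrow> bool" where
  "LDP M X v I \<longleftrightarrow>
     filterlim v at_top sequentially \<and>
     (\<forall>y. I y \<ge> 0) \<and> (\<forall>a::real. closed {y. I y \<le> ereal a}) \<and>
     (\<forall>C. closed C \<longrightarrow>
        limsup (\<lambda>L. ereal (1 / v L) * eln (measure (M L) {\<omega> \<in> space (M L). X L \<omega> \<in> C}))
          \<le> - (INF y\<in>C. I y)) \<and>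
     (\<forall>U. open U \<longrightarrow>
        liminf (\<lambda>L. ereal (1 / v L) * eln (measure (M L) {\<omega> \<in> space (M L). X L \<omega> \<in> U}))
          \<ge> - (INF y\<in>U. I y))"

definition speed :: "real \<Rightarrow> real \<Rightarrow> nat \<Rightarrow> real" where
  "speed k1 \<rho> L = (if k1 < 1 then (1 / k1) ^ L else real L powr (1 / (\<rho> - 1)))"

definition glim :: "(nat \<Rightarrow> real) \<Rightarrow> real \<Rightarrow> real \<Rightarrow> real \<Rightarrow> real" where
  "glim J k1 \<rho> t = lim (\<lambda>L. speed k1 \<rho> L * (1 - (kappa J ^^ L) t))"

definition Bmat :: "real \<Rightarrow> (real \<Rightarrow> real) \<Rightarrow> ('m \<Rightarrow> 'a::real_inner) \<Rightarrow> 'm \<Rightarrow> 'm \<Rightarrow> real" where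
  "Bmat d g xs i j = (LBINT t=-1..1. g t * (1 - t\<^sup>2) powr (d / 2 - 1))
                     / (LBINT t=-1..1. (1 - t\<^sup>2) powr (d / 2 - 1)) - g (xs i \<bullet> xs j)"

definition rate2 :: "('m::finite \<Rightarrow> 'm \<Rightarrow> real) \<Rightarrow> real^'m \<Rightarrow> ereal" where
  "rate2 B y = (SUP \<theta>::real^'m. ereal (\<theta> \<bullet> y - 1/2 * (\<Sum>i\<in>UNIV. \<Sum>j\<in>UNIV. \<theta> $ i * B i j * \<theta> $ j)))"

end

theory Submission
  imports Defs "HOL-Real_Asymp.Real_Asymp"
begin

text \<open>The centered vector is Gaussian: its spherical average is a pointwise limit of finite linear
  combinations of field values, so characteristic functions pass to the limit. By the Funk--Hecke
  formula the covariance matrix of the \<open>L\<close>-th vector has entries \<open>R L - (1 - \<kappa>\<^sub>L(x\<^sub>i \<bullet> x\<^sub>j))\<close>,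
  where \<open>R L\<close> is the weighted mean of \<open>1 - \<kappa>\<^sub>L\<close> over \<open>[-1, 1]\<close>.

  The rescaled functions \<open>v\<^sub>L (1 - \<kappa>\<^sub>L)\<close> converge boundedly. For \<open>\<kappa>'(1) < 1\<close> they decrease in \<open>L\<close>,
  because \<open>1 - \<kappa>(t) \<le> \<kappa>'(1) (1 - t)\<close>. For \<open>\<kappa>'(1) = 1\<close> the increments of \<open>(1 - \<kappa>\<^sub>L(t)) powr (1 - \<rho>)\<close>
  converge, and \<open>\<kappa>(t) > t\<close> on \<open>[-1, 1)\<close>, so all orbits enter \<open>[0, 1]\<close> after a uniform number of steps.

  Hence \<open>v\<^sub>L\<close> times the covariance converges to the matrix of the rate function, and the large
  deviation principle follows from the moment generating functions alone: the upper bound from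
  Chernoff bounds on finitely many half spaces, the lower bound from exponential tilting.\<close>

section \<open>Iterates of the covariance function\<close>

text \<open>For a centered Gaussian vector with covariance \<open>V\<close>, the log moment
  generating function at \<open>v *\<^sub>R \<theta>\<close> is half of v^2 times the quadratic form
  of \<open>V\<close>. Divided by the speed v, it is half the quadratic form of v \<open>V\<close>.
  So convergence of v \<open>V\<close> is exactly convergence of the scaled cumulants, and the rate
  is the Legendre transform of the limit form. The limit matrix can be singular, for example when
  \<kappa> is even and two of the points are antipodal; then the rate is infinite off the range of
  the matrix, while each point of the range is the limit of means of exponentially tilted laws. This
  replaces any inversion of the matrix.

  On the side of \<kappa>, the obstacle is the negative half of [-1, 1], where monotonicity may
  fail. There the comparison with the tangent at 1 still holds, and it yields both the absence of
  other fixed points and a uniform gain per step. On the probabilistic side, the field is known only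
  through characteristic functions of finite combinations, while the average is an integral over the
  sphere and the estimates need real exponentials; hence one passage to the limit and one appeal to
  uniqueness of characteristic functions.\<close>

lemma one_minus_power_le:
  fixes t :: real
  assumes "\<bar>t\<bar> \<le> 1"
  shows "1 - t ^ q \<le> real q * (1 - t)"
proof (induction q)
  case (Suc q)
  have "\<bar>t ^ q\<bar> \<le> 1"
    using assms by (simp add: power_abs power_le_one)
  then have "(1 - t) * (1 - t ^ q) \<ge> 0"
    using assms by simp
  then have "1 - t ^ Suc q \<le> (1 - t) + (1 - t ^ q)"
    by (simp add: algebra_simps)
  with Suc show ?case by (simp add: algebra_simps)
qed simp

text \<open>The gain comes from the quadratic part: 1 - t^2 falls short of 2 (1 - t) by (1 - t)^2.
  This strictness is what later excludes fixed points of the covariance function below 1.\<close>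

lemma one_minus_power_less:
  fixes t :: real
  assumes "\<bar>t\<bar> \<le> 1" "t < 1" "q \<ge> 2"
  shows "1 - t ^ q < real q * (1 - t)"
proof -
  obtain p where q: "q = Suc (Suc p)"
    using assms(3) by (metis add_2_eq_Suc le_Suc_ex)
  have p: "1 - t ^ p \<le> real p * (1 - t)" "\<bar>t ^ p\<bar> \<le> 1"
    using assms one_minus_power_le by (auto simp: power_abs power_le_one)
  have "t\<^sup>2 * (1 - t ^ p) \<le> 1 * (1 - t ^ p)"
    using assms p by (intro mult_right_mono) (auto simp: abs_square_le_1)
  then have le: "t\<^sup>2 * (1 - t ^ p) \<le> real p * (1 - t)"
    using p(1) by simp
  have "0 < (1 - t)\<^sup>2" using assms by simp
  then have less: "1 - t\<^sup>2 < 2 * (1 - t)" by (simp add: power2_eq_square algebra_simps)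
  have "1 - t ^ q = (1 - t\<^sup>2) + t\<^sup>2 * (1 - t ^ p)"
    by (simp add: q power2_eq_square algebra_simps)
  also have "\<dots> < 2 * (1 - t) + real p * (1 - t)"
    using less le by (rule add_less_le_mono)
  finally show ?thesis by (simp add: q algebra_simps)
qed

text \<open>Stolz-Cesaro with denominators \<open>n\<close>: past some \<open>N\<close> every
  increment is within \<open>e/2\<close> of \<open>l\<close>, and the error of the first
  \<open>N\<close> terms is fixed, hence negligible after division by \<open>n\<close>.\<close>

lemma cesaro_increments:
  fixes x :: "nat \<Rightarrow> real"
  assumes "(\<lambda>n. x (Suc n) - x n) \<longlonglongrightarrow> l"
  shows "(\<lambda>n. x n / real n) \<longlonglongrightarrow> l"
proof (rule LIMSEQ_I)
  fix e :: real assume e: "e > 0"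
  from LIMSEQ_D[OF assms, of "e/2"] e obtain N
    where N: "\<And>n. n \<ge> N \<Longrightarrow> \<bar>x (Suc n) - x n - l\<bar> < e/2" by auto
  have bound: "\<bar>x n - x N - real (n - N) * l\<bar> \<le> real (n - N) * (e/2)" if "n \<ge> N" for n
    using that
  proof (induction n rule: dec_induct)
    case (step n)
    define d where "d = real (n - N)"
    have d: "real (Suc n - N) = d + 1" using step by (simp add: d_def)
    have "\<bar>x (Suc n) - x n - l\<bar> < e/2" using N step by auto
    moreover have "x (Suc n) - x N - (d + 1) * l = (x n - x N - d * l) + (x (Suc n) - x n - l)"
      by (simp add: algebra_simps)
    ultimately have "\<bar>x (Suc n) - x N - (d + 1) * l\<bar> \<le> d * (e/2) + e/2"
      using step.IH abs_triangle_ineq[of "x n - x N - d * l" "x (Suc n) - x n - l"]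
      unfolding d_def[symmetric] by linarith
    then show ?case unfolding d by (simp add: distrib_right)
  qed simp
  have "(\<lambda>n. (\<bar>x N\<bar> + real N * \<bar>l\<bar>) / real n) \<longlonglongrightarrow> 0"
    by real_asymp
  from LIMSEQ_D[OF this, of "e/2"] e obtain N'
    where N': "\<And>n. n \<ge> N' \<Longrightarrow> (\<bar>x N\<bar> + real N * \<bar>l\<bar>) / real n < e/2" by fastforce
  show "\<exists>no. \<forall>n\<ge>no. norm (x n / real n - l) < e"
  proof (intro exI allI impI)
    fix n assume n: "n \<ge> max (max N N') 1"
    then have npos: "real n > 0" by simp
    have "x n - real n * l = (x n - x N - real (n - N) * l) + (x N - real N * l)"
      using n by (simp add: of_nat_diff algebra_simps)
    then have "\<bar>x n - real n * l\<bar> \<le> \<bar>x n - x N - real (n - N) * l\<bar> + \<bar>x N - real N * l\<bar>"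
      by (metis abs_triangle_ineq)
    also have "\<dots> \<le> real (n - N) * (e/2) + (\<bar>x N\<bar> + real N * \<bar>l\<bar>)"
      using bound[of n] n abs_triangle_ineq4[of "x N" "real N * l"] by (auto simp: abs_mult)
    also have "\<dots> < real n * (e/2) + real n * (e/2)"
    proof (rule add_le_less_mono)
      show "real (n - N) * (e/2) \<le> real n * (e/2)"
        using e by (intro mult_right_mono) auto
      show "\<bar>x N\<bar> + real N * \<bar>l\<bar> < real n * (e/2)"
        using N'[of n] n npos by (simp add: field_simps)
    qed
    finally have "\<bar>x n - real n * l\<bar> < real n * e" by (simp add: mult.commute)
    moreover have "x n / real n - l = (x n - real n * l) / real n"
      using npos by (simp add: field_simps)
    ultimately show "norm (x n / real n - l) < e"
      using npos by (simp add: field_simps)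
  qed
qed

text \<open>The recursion is linearised by the substitution \<open>u \<mapsto> u powr (1 - \<rho>)\<close>: its increments converge.\<close>
lemma iterate_powr_asymp:
  fixes u :: "nat \<Rightarrow> real"
  assumes pos: "\<And>n. u n > 0" and lim: "u \<longlonglongrightarrow> 0" and rho: "\<rho> > 1" and c: "c \<noteq> 0"
    and dec: "\<And>n. u (Suc n) \<le> u n"
    and step: "(\<lambda>n. (u n - u (Suc n)) / u n powr \<rho>) \<longlonglongrightarrow> c"
  shows "(\<lambda>n. real n powr (1 / (\<rho> - 1)) * u n) \<longlonglongrightarrow> (c * (\<rho> - 1)) powr (- (1 / (\<rho> - 1)))"
proof -
  define a where "a = \<rho> - 1"
  have a: "a > 0" "\<rho> = 1 + a" using rho by (auto simp: a_def)
  define z where "z n = (u n - u (Suc n)) / u n" for n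
  have za: "(\<lambda>n. z n / u n powr a) \<longlonglongrightarrow> c"
  proof -
    have "u n powr \<rho> = u n * u n powr a" for n
      using pos[of n] by (simp add: a powr_add)
    then show ?thesis using step by (simp add: z_def)
  qed
  have "(\<lambda>n. u n powr a) \<longlonglongrightarrow> 0"
    using tendsto_powr2[OF lim tendsto_const[of a]] pos a by (auto simp: less_imp_le)
  with za have "(\<lambda>n. (z n / u n powr a) * u n powr a) \<longlonglongrightarrow> c * 0"
    by (intro tendsto_mult)
  then have z0: "z \<longlonglongrightarrow> 0"
    using pos by (simp add: less_imp_neq[symmetric])
  \<comment> \<open>The Caratheodory form of the derivative gives an exact factorisation with a
    continuous factor \<open>h\<close>, so no remainder has to be estimated and no division by
    \<open>z n\<close> occurs.\<close>
  have "((\<lambda>x. (1 - x) powr (- a)) has_real_derivative a) (at 0)"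
    by (auto intro!: derivative_eq_intros)
  then obtain h where h: "\<And>x. (1 - x) powr (- a) - 1 = h x * x" "isCont h 0" "h 0 = a"
    unfolding CARAT_DERIV by auto
  have hz: "(\<lambda>n. h (z n)) \<longlonglongrightarrow> a"
    using isCont_tendsto_compose[OF h(2) z0] h(3) by simp
  define y where "y n = u n powr (- a)" for n
  have inc: "y (Suc n) - y n = (z n / u n powr a) * h (z n)" for n
  proof -
    have "u (Suc n) = u n * (1 - z n)" "0 < 1 - z n"
      using pos[of n] pos[of "Suc n"] by (auto simp: z_def field_simps)
    then have "y (Suc n) = y n * (1 - z n) powr (- a)"
      using pos[of n] by (simp add: y_def powr_mult)
    then have "y (Suc n) - y n = y n * (h (z n) * z n)"
      using h(1)[of "z n"] by (simp add: algebra_simps)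
    then show ?thesis using pos[of n] by (simp add: y_def powr_minus field_simps)
  qed
  have incl: "(\<lambda>n. y (Suc n) - y n) \<longlonglongrightarrow> c * a"
    unfolding inc by (intro tendsto_mult za hz)
  then have ylim: "(\<lambda>n. y n / real n) \<longlonglongrightarrow> c * a"
    by (rule cesaro_increments)
  \<comment> \<open>Only \<open>c \<noteq> 0\<close> is known so far. The sign is forced:
    \<open>y n\<close> is nonnegative, so its mean growth rate cannot be negative.\<close>
  have "c * a \<ge> 0"
  proof (rule LIMSEQ_le_const[OF ylim], intro exI allI impI)
    show "0 \<le> y n / real n" for n by (simp add: y_def)
  qed
  then have ca: "c * a > 0" using c a by (simp add: less_le)
  have "(\<lambda>n. (y n / real n) powr (- (1 / a))) \<longlonglongrightarrow> (c * a) powr (- (1 / a))"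
    using ca by (intro tendsto_powr ylim tendsto_const) auto
  moreover have "\<forall>\<^sub>F n in sequentially.
      (y n / real n) powr (- (1 / a)) = real n powr (1 / a) * u n"
    using eventually_gt_at_top[of 0]
  proof eventually_elim
    case (elim n)
    have "(y n / real n) powr (- (1 / a)) = y n powr (- (1 / a)) / real n powr (- (1 / a))"
      using elim by (intro powr_divide)
    also have "y n powr (- (1 / a)) = u n"
      using a pos[of n] by (simp add: y_def powr_powr)
    also have "u n / real n powr (- (1 / a)) = real n powr (1 / a) * u n"
      using elim by (simp add: powr_minus field_simps)
    finally show ?case .
  qed
  ultimately show ?thesis
    unfolding a_def[symmetric] by (rule Lim_transform_eventually)
qed

text \<open>The derivative at 1 is one-sided because the series may diverge beyond 1, where
  \<open>k\<close> takes unspecified values. \<open>b_higher\<close> excludes affine series, among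
  them the identity, for which every point is fixed.\<close>

locale unit_power_series =
  fixes b :: "nat \<Rightarrow> real" and k :: "real \<Rightarrow> real" and k1 :: real
  assumes b_nonneg: "\<And>q. b q \<ge> 0"
    and b_sums: "b sums 1"
    and b_higher: "\<exists>q\<ge>2. b q > 0"
    and k_eq: "\<And>t. k t = (\<Sum>q. b q * t ^ q)"
    and k_deriv: "(k has_real_derivative k1) (at_left 1)"
    and k1_le: "k1 \<le> 1"
begin

lemma b_summable: "summable b"
  using b_sums by (rule sums_summable)

lemma k_summable: "\<bar>t\<bar> \<le> 1 \<Longrightarrow> summable (\<lambda>q. b q * t ^ q)"
proof (rule summable_comparison_test'[OF b_summable, of 0])
  fix q assume "\<bar>t\<bar> \<le> 1"
  then have "b q * \<bar>t\<bar> ^ q \<le> b q * 1"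
    using b_nonneg by (intro mult_left_mono power_le_one) auto
  then show "norm (b q * t ^ q) \<le> b q"
    using b_nonneg[of q] by (simp add: abs_mult power_abs)
qed

lemma k_1 [simp]: "k 1 = 1"
  using b_sums by (simp add: k_eq sums_iff)

lemma one_minus_k_sums:
  assumes "\<bar>t\<bar> \<le> 1"
  shows "(\<lambda>q. b q * (1 - t ^ q)) sums (1 - k t)"
  using sums_diff[OF b_sums summable_sums[OF k_summable[OF assms]]]
  by (simp add: k_eq algebra_simps)

text \<open>The omitted terms \<open>b q * (1 - t ^ q)\<close> are nonnegative, so difference
  quotients at 1 of the truncated polynomial lie below those of \<open>k\<close>; let t tend to 1.
  This bounds the partial sums of \<open>real q * b q\<close> and makes that series
  summable.\<close>

lemma partial_derivative_le: "(\<Sum>q<N. real q * b q) \<le> k1"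
proof -
  define P where "P t = (\<Sum>q<N. b q * t ^ q)" for t
  have dP: "(P has_real_derivative (\<Sum>q<N. real q * b q)) (at_left 1)"
    unfolding P_def by (auto intro!: derivative_eq_intros sum.cong)
  have lim: "((\<lambda>t. (P t - P 1) / (t - 1)) \<longlongrightarrow> (\<Sum>q<N. real q * b q)) (at_left 1)"
            "((\<lambda>t. (k t - k 1) / (t - 1)) \<longlongrightarrow> k1) (at_left 1)"
    using dP k_deriv by (simp_all add: has_field_derivative_iff)
  show ?thesis
  proof (rule tendsto_le[OF trivial_limit_at_left_real lim(2,1)])
    have "\<forall>\<^sub>F t in at_left (1::real). t \<in> {0<..<1}"
      by (intro eventually_at_left_real) simp
    then show "\<forall>\<^sub>F t in at_left 1. (P t - P 1) / (t - 1) \<le> (k t - k 1) / (t - 1)"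
    proof eventually_elim
      case (elim t)
      have "P 1 - P t = (\<Sum>q<N. b q * (1 - t ^ q))"
        by (simp add: P_def sum_subtractf algebra_simps)
      also have "\<dots> \<le> (\<Sum>q. b q * (1 - t ^ q))"
        using elim b_nonneg one_minus_k_sums[of t]
        by (intro sum_le_suminf) (auto simp: sums_iff power_le_one)
      also have "\<dots> = k 1 - k t" using one_minus_k_sums[of t] elim by (simp add: sums_iff)
      finally show ?case using elim by (simp add: divide_simps)
    qed
  qed
qed

lemma qb_summable: "summable (\<lambda>q. real q * b q)"
  using b_nonneg partial_derivative_le by (intro summableI_nonneg_bounded) auto

text \<open>Sum the bounds for 1 - t^q against \<open>b q\<close>; one coefficient of index at least
  2 is positive, which makes the sum strict.\<close>

lemma one_minus_k_less:
  assumes "\<bar>t\<bar> \<le> 1" "t < 1"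
  shows "1 - k t < k1 * (1 - t)"
proof -
  obtain p where p: "p \<ge> 2" "b p > 0" using b_higher by blast
  have s: "(\<lambda>q. real q * b q * (1 - t) - b q * (1 - t ^ q)) sums
      ((\<Sum>q. real q * b q) * (1 - t) - (1 - k t))"
    by (intro sums_diff sums_mult2 summable_sums qb_summable one_minus_k_sums assms)
  have nn: "0 \<le> real q * b q * (1 - t) - b q * (1 - t ^ q)" for q
    using mult_left_mono[OF one_minus_power_le[OF assms(1), of q] b_nonneg[of q]]
    by (simp add: algebra_simps)
  have "0 < (\<Sum>q. real q * b q * (1 - t) - b q * (1 - t ^ q))"
  proof (rule suminf_pos2[OF sums_summable[OF s] nn])
    show "0 < real p * b p * (1 - t) - b p * (1 - t ^ p)"
      using mult_strict_left_mono[OF one_minus_power_less[OF assms p(1)] p(2)]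
      by (simp add: algebra_simps)
  qed
  then have "1 - k t < (\<Sum>q. real q * b q) * (1 - t)"
    using s by (simp add: sums_iff)
  also have "\<dots> \<le> k1 * (1 - t)"
    using assms by (intro mult_right_mono suminf_le_const qb_summable partial_derivative_le) auto
  finally show ?thesis .
qed

lemma one_minus_k_le: "\<bar>t\<bar> \<le> 1 \<Longrightarrow> 1 - k t \<le> k1 * (1 - t)"
  using one_minus_k_less[of t] by (cases "t < 1") (auto simp: not_less)

lemma k1_pos: "k1 > 0"
proof -
  obtain p where p: "p \<ge> 2" "b p > 0" using b_higher by blast
  have "0 < real p * b p" using p by simp
  also have "\<dots> \<le> (\<Sum>q<Suc p. real q * b q)"
    using b_nonneg by (intro member_le_sum) auto
  also have "\<dots> \<le> k1" by (rule partial_derivative_le)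
  finally show ?thesis .
qed

lemma abs_k_le: assumes "\<bar>t\<bar> \<le> 1" shows "\<bar>k t\<bar> \<le> 1"
proof -
  have "\<bar>k t\<bar> \<le> (\<Sum>q. b q)"
    unfolding k_eq real_norm_def[symmetric]
  proof (rule norm_suminf_le[OF _ b_summable])
    show "norm (b q * t ^ q) \<le> b q" for q
      using mult_left_mono[OF power_le_one[of "\<bar>t\<bar>" q] b_nonneg[of q]] assms b_nonneg[of q]
      by (simp add: abs_mult power_abs)
  qed
  then show ?thesis using b_sums by (simp add: sums_iff)
qed

lemma k_mono: assumes "0 \<le> s" "s \<le> t" "t \<le> 1" shows "k s \<le> k t"
  unfolding k_eq using assms b_nonneg
  by (intro suminf_le k_summable mult_left_mono power_mono) auto

lemma k_nonneg: "0 \<le> t \<Longrightarrow> t \<le> 1 \<Longrightarrow> 0 \<le> k t"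
  unfolding k_eq using b_nonneg by (intro suminf_nonneg k_summable) auto

lemma continuous_on_k: "continuous_on {-1..1} k"
proof -
  have "uniform_limit {-1..1} (\<lambda>n t. \<Sum>q<n. b q * t ^ q) (\<lambda>t. \<Sum>q. b q * t ^ q) sequentially"
  proof (rule Weierstrass_m_test[OF _ b_summable])
    fix q and t :: real assume "t \<in> {-1..1}"
    then have "\<bar>t\<bar> \<le> 1" by auto
    then show "norm (b q * t ^ q) \<le> b q"
      using mult_left_mono[OF power_le_one[of "\<bar>t\<bar>" q] b_nonneg[of q]] b_nonneg[of q]
      by (simp add: abs_mult power_abs)
  qed
  then have "continuous_on {-1..1} (\<lambda>t. \<Sum>q. b q * t ^ q)"
    by (rule uniform_limit_theorem[rotated]) (auto intro!: always_eventually continuous_intros)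
  then show ?thesis by (simp add: k_eq[abs_def])
qed

section \<open>Orbits in [-1, 1]\<close>

lemma abs_iter_le: "\<bar>t\<bar> \<le> 1 \<Longrightarrow> \<bar>(k ^^ L) t\<bar> \<le> 1"
  by (induction L) (auto intro: abs_k_le)

lemma iter_mem: "t \<in> {-1..1} \<Longrightarrow> (k ^^ L) t \<in> {-1..1}"
  using abs_iter_le[of t L] by (auto simp: abs_le_iff)

lemma iter_1 [simp]: "(k ^^ L) 1 = 1"
  by (induction L) auto

lemma continuous_on_iter: "continuous_on {-1..1} (k ^^ L)"
proof (induction L)
  case (Suc L)
  show ?case
    unfolding funpow.simps comp_def using Suc iter_mem
    by (intro continuous_on_compose2[OF continuous_on_k]) auto
qed (auto intro: continuous_intros)

text \<open>Monotonicity of \<open>k\<close> is available on [0, 1] only, so the induction has to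
  carry along that the orbit stays nonnegative.\<close>

lemma iter_mono: "0 \<le> s \<Longrightarrow> s \<le> t \<Longrightarrow> t \<le> 1 \<Longrightarrow> (k ^^ L) s \<le> (k ^^ L) t \<and> 0 \<le> (k ^^ L) s"
proof (induction L)
  case (Suc L)
  then show ?case using abs_iter_le[of s L] abs_iter_le[of t L]
    by (auto intro!: k_mono k_nonneg simp: abs_le_iff)
qed auto

lemma iter_Suc_ge:
  assumes "\<bar>t\<bar> \<le> 1"
  shows "1 - (k ^^ Suc L) t \<le> k1 * (1 - (k ^^ L) t)"
  using one_minus_k_le[OF abs_iter_le[OF assms, of L]] by simp

lemma subcritical_antimono:
  assumes "\<bar>t\<bar> \<le> 1"
  shows "decseq (\<lambda>L. (1 / k1) ^ L * (1 - (k ^^ L) t))"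
proof (rule decseq_SucI)
  fix L
  have "(1 / k1) ^ Suc L * (1 - (k ^^ Suc L) t) \<le> (1 / k1) ^ Suc L * (k1 * (1 - (k ^^ L) t))"
    using iter_Suc_ge[OF assms, of L] k1_pos by (intro mult_left_mono) auto
  also have "\<dots> = (1 / k1) ^ L * (1 - (k ^^ L) t)" using k1_pos by simp
  finally show "(1 / k1) ^ Suc L * (1 - (k ^^ Suc L) t) \<le> (1 / k1) ^ L * (1 - (k ^^ L) t)" .
qed

lemma iter_antimono:
  assumes "\<bar>t\<bar> \<le> 1"
  shows "1 - (k ^^ Suc L) t \<le> 1 - (k ^^ L) t"
proof -
  have "k1 * (1 - (k ^^ L) t) \<le> 1 * (1 - (k ^^ L) t)"
    using k1_le abs_iter_le[OF assms, of L] by (intro mult_right_mono) auto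
  with iter_Suc_ge[OF assms, of L] show ?thesis by simp
qed

text \<open>Orbits increase, so they converge to a fixed point of \<open>k\<close>; below 1 the
  strict tangent bound with \<open>k1 \<le> 1\<close> leaves none.\<close>

lemma iter_tendsto_1:
  assumes t: "\<bar>t\<bar> \<le> 1"
  shows "(\<lambda>L. (k ^^ L) t) \<longlonglongrightarrow> 1"
proof -
  have "incseq (\<lambda>L. (k ^^ L) t)"
    using iter_antimono[OF t] by (intro incseq_SucI) auto
  then obtain s where s: "(\<lambda>L. (k ^^ L) t) \<longlonglongrightarrow> s"
    using incseq_convergent[of "\<lambda>L. (k ^^ L) t" 1] abs_iter_le[OF t] by (metis abs_le_D1)
  have sm: "s \<in> {-1..1}"
    by (rule Lim_in_closed_set[OF closed_atLeastAtMost _ _ s])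
       (use iter_mem[of t] t in \<open>auto intro!: always_eventually simp: abs_le_iff\<close>)
  have "(\<lambda>L. k ((k ^^ L) t)) \<longlonglongrightarrow> k s"
    by (rule continuous_on_tendsto_compose[OF continuous_on_k s sm])
       (use iter_mem[of t] t in \<open>auto intro!: always_eventually simp: abs_le_iff\<close>)
  moreover have "(\<lambda>L. k ((k ^^ L) t)) \<longlonglongrightarrow> s"
    using LIMSEQ_Suc[OF s] by simp
  ultimately have ks: "k s = s" using LIMSEQ_unique by blast
  have "s = 1"
  proof (rule ccontr)
    assume "s \<noteq> 1"
    then have s1: "s < 1" "\<bar>s\<bar> \<le> 1" using sm by auto
    then have "1 - s < k1 * (1 - s)" using one_minus_k_less[of s] ks by simp
    also have "\<dots> \<le> 1 * (1 - s)" using k1_le s1 by (intro mult_right_mono) auto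
    finally show False by simp
  qed
  with s show ?thesis by simp
qed

text \<open>On the compact interval [-1, 0] the gain \<open>k t - t\<close> has a positive minimum
  \<delta>, so an orbit starting at -1 or above leaves the negative half within about 1/\<delta>
  steps, uniformly in the starting point.\<close>

lemma iter_eventually_nonneg: "\<exists>L0. \<forall>t\<in>{-1..1}. (k ^^ L0) t \<ge> 0"
proof -
  have "continuous_on {-1..0} (\<lambda>t. k t - t)"
    by (intro continuous_intros continuous_on_subset[OF continuous_on_k]) auto
  then obtain s where s: "s \<in> {-1..0}" "\<And>t. t \<in> {-1..0} \<Longrightarrow> k s - s \<le> k t - t"
    using continuous_attains_inf[of "{-1..0::real}" "\<lambda>t. k t - t"] by auto
  define \<delta> where "\<delta> = k s - s"
  have "1 - k s < k1 * (1 - s)" using s by (intro one_minus_k_less) auto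
  also have "\<dots> \<le> 1 * (1 - s)" using k1_le s by (intro mult_right_mono) auto
  finally have \<delta>: "\<delta> > 0" by (simp add: \<delta>_def)
  have step: "(k ^^ L) t \<ge> min 0 (-1 + real L * \<delta>)" if "t \<in> {-1..1}" for t L
  proof (induction L)
    case (Suc L)
    have m: "(k ^^ L) t \<in> {-1..1}" using iter_mem that by blast
    show ?case
    proof (cases "(k ^^ L) t \<ge> 0")
      case True
      then show ?thesis using k_nonneg[of "(k ^^ L) t"] m by auto
    next
      case False
      then have "k ((k ^^ L) t) \<ge> (k ^^ L) t + \<delta>"
        using s(2)[of "(k ^^ L) t"] m by (auto simp: \<delta>_def)
      then show ?thesis using Suc \<delta> False by (auto simp: algebra_simps min_def split: if_splits)
    qed
  qed (use that in auto)
  obtain L0 :: nat where "1 / \<delta> \<le> real L0" using real_arch_simple by blast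
  then have "-1 + real L0 * \<delta> \<ge> 0" using \<delta> by (simp add: field_simps)
  then show ?thesis using step[of _ L0] by (intro exI[of _ L0]) force
qed

lemma critical_limit:
  assumes t: "t \<in> {-1..1}" and k11: "k1 = 1" and c: "c \<noteq> 0" and rho: "\<rho> > 1"
    and o: "(\<lambda>t. (1 - k t) - (k1 * (1 - t) - c * (1 - t) powr \<rho>)) \<in> o[at_left 1](\<lambda>t. (1 - t) powr \<rho>)"
  shows "convergent (\<lambda>L. real L powr (1 / (\<rho> - 1)) * (1 - (k ^^ L) t))"
proof (cases "\<exists>N. (k ^^ N) t = 1")
  \<comment> \<open>An orbit can hit 1 exactly, for instance from -1 when \<open>k\<close> is even.
    Then the substitution by a negative power is undefined, but the rescaled sequence is eventually
    0.\<close>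
  case True
  then obtain N where N: "(k ^^ N) t = 1" by blast
  have "(k ^^ n) t = 1" if "n \<ge> N" for n
  proof -
    have "(k ^^ n) t = (k ^^ (n - N)) ((k ^^ N) t)"
      using that by (metis comp_apply funpow_add le_add_diff_inverse2)
    then show ?thesis using N by simp
  qed
  then have "\<forall>\<^sub>F n in sequentially. 0 = real n powr (1 / (\<rho> - 1)) * (1 - (k ^^ n) t)"
    by (intro eventually_sequentiallyI[of N]) auto
  then show ?thesis
    by (intro convergentI[of _ 0] Lim_transform_eventually[OF tendsto_const])
next
  case False
  have t1: "\<bar>t\<bar> \<le> 1" using t by auto
  define u where "u L = 1 - (k ^^ L) t" for L
  have less: "(k ^^ n) t < 1" for n
    using False abs_iter_le[OF t1, of n] by (auto simp: less_le)
  then have upos: "u n > 0" for n by (simp add: u_def)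
  have lim: "u \<longlonglongrightarrow> 0"
    unfolding u_def using tendsto_diff[OF tendsto_const[of 1] iter_tendsto_1[OF t1]] by simp
  have dec: "u (Suc n) \<le> u n" for n
    unfolding u_def by (rule iter_antimono[OF t1])
  have "filterlim (\<lambda>L. (k ^^ L) t) (at_left 1) sequentially"
    using less by (intro tendsto_imp_filterlim_at_left iter_tendsto_1 t1 always_eventually) auto
  from filterlim_compose[OF smalloD_tendsto[OF o] this]
  have "(\<lambda>n. ((1 - k ((k ^^ n) t)) - (k1 * (1 - (k ^^ n) t) - c * (1 - (k ^^ n) t) powr \<rho>))
          / (1 - (k ^^ n) t) powr \<rho>) \<longlonglongrightarrow> 0" .
  from tendsto_diff[OF tendsto_const[of c] this]
  have "(\<lambda>n. c - ((1 - k ((k ^^ n) t)) - (k1 * (1 - (k ^^ n) t) - c * (1 - (k ^^ n) t) powr \<rho>))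
          / (1 - (k ^^ n) t) powr \<rho>) \<longlonglongrightarrow> c" by simp
  moreover have "c - ((1 - k ((k ^^ n) t)) - (k1 * (1 - (k ^^ n) t) - c * (1 - (k ^^ n) t) powr \<rho>))
          / (1 - (k ^^ n) t) powr \<rho> = (u n - u (Suc n)) / u n powr \<rho>" for n
  proof -
    have "u n powr \<rho> > 0" using upos[of n] by simp
    then show ?thesis unfolding u_def k11 by (simp add: field_simps)
  qed
  ultimately have "(\<lambda>n. (u n - u (Suc n)) / u n powr \<rho>) \<longlonglongrightarrow> c" by simp
  from iterate_powr_asymp[OF upos lim rho c dec this] show ?thesis
    unfolding u_def by (rule convergentI)
qed

section \<open>Rescaling by the speed: limits and uniform bounds\<close>

lemma speed_at_top:
  assumes "k1 = 1 \<longrightarrow> \<rho> > 1"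
  shows "filterlim (speed k1 \<rho>) at_top sequentially"
proof (cases "k1 < 1")
  case True
  have "filterlim (\<lambda>L. (1 / k1) ^ L) at_top sequentially"
  proof -
    have "1 / k1 > 1" using True k1_pos by simp
    then show ?thesis using filterlim_at_infinity_imp_filterlim_at_top[OF filterlim_realpow_sequentially_gt1[of "1 / k1"]] k1_pos by auto
  qed
  then show ?thesis using True by (simp add: speed_def[abs_def])
next
  case False
  then have "\<rho> > 1" using assms k1_le by simp
  then have "1 / (\<rho> - 1) > 0" by simp
  then have "filterlim (\<lambda>L. real L powr (1 / (\<rho> - 1))) at_top sequentially"
    by real_asymp
  then show ?thesis using False by (simp add: speed_def[abs_def])
qed

lemma speed_nonneg: "speed k1 \<rho> L \<ge> 0"
  using k1_pos by (simp add: speed_def)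

lemma rescaled_iter_convergent:
  assumes t: "t \<in> {-1..1}"
    and crit: "k1 = 1 \<longrightarrow> c \<noteq> 0 \<and> \<rho> > 1 \<and>
       (\<lambda>t. (1 - k t) - (k1 * (1 - t) - c * (1 - t) powr \<rho>)) \<in> o[at_left 1](\<lambda>t. (1 - t) powr \<rho>)"
  shows "convergent (\<lambda>L. speed k1 \<rho> L * (1 - (k ^^ L) t))"
proof (cases "k1 < 1")
  case True
  have t1: "\<bar>t\<bar> \<le> 1" using t by auto
  have "0 \<le> (1 / k1) ^ L * (1 - (k ^^ L) t)" for L
    using k1_pos abs_iter_le[OF t1, of L] by auto
  then have "convergent (\<lambda>L. (1 / k1) ^ L * (1 - (k ^^ L) t))"
    using decseq_convergent[OF subcritical_antimono[OF t1], of 0] by (meson convergentI)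
  then show ?thesis using True by (simp add: speed_def)
next
  case False
  then show ?thesis using critical_limit[OF t, of c \<rho>] crit k1_le by (simp add: speed_def)
qed

text \<open>Supplies the dominating constant on [-1, 1]. In the critical case, \<open>L0\<close>
  steps bring every orbit into [0, 1], where monotonicity keeps it above the orbit of 0; that single
  orbit is bounded after rescaling because it converges.\<close>

lemma rescaled_iter_bounded:
  assumes crit: "k1 = 1 \<longrightarrow> c \<noteq> 0 \<and> \<rho> > 1 \<and>
       (\<lambda>t. (1 - k t) - (k1 * (1 - t) - c * (1 - t) powr \<rho>)) \<in> o[at_left 1](\<lambda>t. (1 - t) powr \<rho>)"
  shows "\<exists>C N. \<forall>L\<ge>N. \<forall>t\<in>{-1..1}. speed k1 \<rho> L * (1 - (k ^^ L) t) \<le> C"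
proof (cases "k1 < 1")
  case True
  \<comment> \<open>The rescaled sequence decreases from its value 1 - t at
    \<open>L = 0\<close>.\<close>
  have "speed k1 \<rho> L * (1 - (k ^^ L) t) \<le> 2" if "t \<in> {-1..1}" for t L
  proof -
    have "\<bar>t\<bar> \<le> 1" using that by auto
    from decseqD[OF subcritical_antimono[OF this], of 0 L] show ?thesis
      using that True by (simp add: speed_def)
  qed
  then show ?thesis by blast
next
  case False
  then have k11: "k1 = 1" and rho: "\<rho> > 1" using k1_le crit by auto
  define a where "a = 1 / (\<rho> - 1)"
  have a: "a > 0" using rho by (simp add: a_def)
  have speed: "speed k1 \<rho> L = real L powr a" for L using False by (simp add: speed_def a_def)
  have "convergent (\<lambda>L. speed k1 \<rho> L * (1 - (k ^^ L) 0))"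
    by (rule rescaled_iter_convergent[OF _ crit]) auto
  then have "Bseq (\<lambda>L. speed k1 \<rho> L * (1 - (k ^^ L) 0))"
    by (rule convergent_imp_Bseq)
  then obtain C where C: "\<And>L. \<bar>speed k1 \<rho> L * (1 - (k ^^ L) 0)\<bar> \<le> C"
    using BseqE[of "\<lambda>L. speed k1 \<rho> L * (1 - (k ^^ L) 0)"] unfolding real_norm_def by blast
  obtain L0 where L0: "\<And>t. t \<in> {-1..1} \<Longrightarrow> (k ^^ L0) t \<ge> 0" using iter_eventually_nonneg by blast
  have "speed k1 \<rho> L * (1 - (k ^^ L) t) \<le> 2 powr a * C" if L: "L \<ge> 2 * L0 + 1" and t: "t \<in> {-1..1}" for L t
  proof -
    define n where "n = L - L0"
    have n: "L = n + L0" "L \<le> 2 * n" using L by (auto simp: n_def)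
    have "(k ^^ n) 0 \<le> (k ^^ n) ((k ^^ L0) t)"
      using iter_mono[of 0 "(k ^^ L0) t" n] L0[OF t] iter_mem[OF t, of L0] by auto
    also have "\<dots> = (k ^^ L) t" by (simp add: n funpow_add)
    finally have le: "1 - (k ^^ L) t \<le> 1 - (k ^^ n) 0" by simp
    \<comment> \<open>The delay of \<open>L0\<close> steps costs only this constant factor, because
      \<open>L \<le> 2 * n\<close>.\<close>
    have "speed k1 \<rho> L \<le> 2 powr a * speed k1 \<rho> n"
      unfolding speed using n a by (subst powr_mult[symmetric]) (auto intro!: powr_mono2)
    then have "speed k1 \<rho> L * (1 - (k ^^ L) t) \<le> (2 powr a * speed k1 \<rho> n) * (1 - (k ^^ n) 0)"
      using le iter_mem[OF t, of L] speed_nonneg by (intro mult_mono) auto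
    also have "\<dots> \<le> 2 powr a * C" using C[of n] by (simp add: mult.assoc)
    finally show ?thesis .
  qed
  then show ?thesis by blast
qed

end

lemma unit_power_series_kappa:
  assumes "infinite {q. J q \<noteq> 0}"
    and "(\<lambda>q. (J q)\<^sup>2 / fact q) sums 1"
    and "(kappa J has_real_derivative k1) (at_left 1)" "k1 \<le> 1"
  shows "unit_power_series (\<lambda>q. (J q)\<^sup>2 / fact q) (kappa J) k1"
proof
  have "\<not> {q. J q \<noteq> 0} \<subseteq> {..<2}"
    using assms(1) finite_subset by blast
  then obtain q where "q \<notin> {..<2}" "J q \<noteq> 0" by blast
  then have "q \<ge> 2" "J q \<noteq> 0" by auto
  then show "\<exists>q\<ge>2. (J q)\<^sup>2 / fact q > 0" by (intro exI[of _ q]) auto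
qed (use assms in \<open>auto simp: kappa_def\<close>)

section \<open>The Funk--Hecke formula for the cone measure\<close>

lemma nn_integral_lborel_translate:
  fixes c :: "'a::euclidean_space"
  assumes [measurable]: "g \<in> borel_measurable borel"
  shows "(\<integral>\<^sup>+y. g (c + y) \<partial>lborel) = (\<integral>\<^sup>+y. g y \<partial>lborel)"
  by (subst (2) lborel_distr_plus[of c, symmetric]) (simp add: nn_integral_distr)

lemma nn_integral_lborel_reflect:
  fixes c :: "'a::euclidean_space"
  assumes [measurable]: "g \<in> borel_measurable borel"
  shows "(\<integral>\<^sup>+y. g (c - y) \<partial>lborel) = (\<integral>\<^sup>+y. g y \<partial>lborel)"
  by (subst (2) lborel_affine[of "-1" c])
     (simp_all add: nn_integral_density nn_integral_distr)

text \<open>The argument behind the uniqueness of Haar measure: integrate \<open>indicator A (f x) * indicator B y\<close>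
  in two ways, with \<open>B\<close> the unit ball, which \<open>f\<close> preserves.\<close>
lemma distr_lborel_orthogonal_transformation:
  fixes f :: "'a::euclidean_space \<Rightarrow> 'a"
  assumes f: "orthogonal_transformation f"
  shows "distr lborel borel f = lborel"
proof (rule measure_eqI)
  have lin: "linear f" using f by (simp add: orthogonal_transformation)
  have nf: "norm (f x) = norm x" for x using f by (simp add: orthogonal_transformation)
  have fm[measurable]: "f \<in> borel_measurable borel"
    by (intro borel_measurable_continuous_onI linear_continuous_on linear_conv_bounded_linear[THEN iffD1] lin)
  fix A assume "A \<in> sets (distr lborel borel f)"
  then have [measurable]: "A \<in> sets borel" by simp
  define B :: "'a set" where "B = ball 0 1"
  have [measurable]: "B \<in> sets borel" by (simp add: B_def)
  have fB: "indicator B (f x) = (indicator B x :: ennreal)" for x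
    by (simp add: B_def indicator_def nf)
  have "emeasure lborel (f -` A) * emeasure lborel B =
      (\<integral>\<^sup>+x. indicator A (f x) * (\<integral>\<^sup>+y. indicator B y \<partial>lborel) \<partial>lborel)"
    using measurable_sets[OF fm, of A]
    by (simp add: nn_integral_multc indicator_vimage[symmetric] flip: indicator_vimage)
  also have "\<dots> = (\<integral>\<^sup>+x. \<integral>\<^sup>+y. indicator A (f x) * indicator B (f x + y) \<partial>lborel \<partial>lborel)"
    by (simp add: nn_integral_cmult nn_integral_lborel_translate[of "indicator B"])
  also have "\<dots> = (\<integral>\<^sup>+y. \<integral>\<^sup>+x. indicator A (f x) * indicator B (f x + y) \<partial>lborel \<partial>lborel)"
    by (rule lborel_pair.Fubini') simp
  also have "\<dots> = (\<integral>\<^sup>+y. \<integral>\<^sup>+x. indicator A (f x - y) * indicator B (f x) \<partial>lborel \<partial>lborel)"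
  proof (rule nn_integral_cong)
    fix y :: 'a
    \<comment> \<open>Surjectivity of \<open>f\<close> turns the shift by \<open>y\<close> in the
      image into a shift by \<open>z\<close> of the integration variable.\<close>
    obtain z where z: "f z = y" using orthogonal_transformation_surj[OF f] by (metis surjD)
    have "(\<integral>\<^sup>+x. indicator A (f x) * indicator B (f x + y) \<partial>lborel) =
        (\<integral>\<^sup>+x. indicator A (f (- z + x)) * indicator B (f (- z + x) + y) \<partial>lborel)"
      by (rule nn_integral_lborel_translate[symmetric]) simp
    then show "(\<integral>\<^sup>+x. indicator A (f x) * indicator B (f x + y) \<partial>lborel) =
        (\<integral>\<^sup>+x. indicator A (f x - y) * indicator B (f x) \<partial>lborel)"
      by (simp add: linear_diff[OF lin] z)
  qed
  also have "\<dots> = (\<integral>\<^sup>+x. \<integral>\<^sup>+y. indicator A (f x - y) * indicator B (f x) \<partial>lborel \<partial>lborel)"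
    by (rule lborel_pair.Fubini') simp
  also have "\<dots> = (\<integral>\<^sup>+x. (\<integral>\<^sup>+y. indicator A y \<partial>lborel) * indicator B x \<partial>lborel)"
    by (simp add: nn_integral_multc nn_integral_lborel_reflect[of "indicator A"] fB)
  also have "\<dots> = emeasure lborel A * emeasure lborel B"
    by (simp add: nn_integral_cmult)
  finally have "emeasure lborel (f -` A) * emeasure lborel B = emeasure lborel A * emeasure lborel B" .
  moreover have "emeasure lborel B \<noteq> 0" "emeasure lborel B \<noteq> \<top>"
    using unit_ball_vol_pos[of "real DIM('a)", THEN less_imp_neq]
    by (simp_all add: B_def emeasure_ball del: unit_ball_vol_pos)
  ultimately have "emeasure lborel (f -` A) = emeasure lborel A"
    by (metis ennreal_mult_divide_eq)
  then show "emeasure (distr lborel borel f) A = emeasure lborel A"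
    by (simp add: emeasure_distr)
qed simp

text \<open>Householder reflection; for \<open>a = b\<close> the coefficient is the junk value \<open>x / 0 = 0\<close>.\<close>
lemma orthogonal_transformation_between:
  fixes a b :: "'a::euclidean_space"
  assumes "norm a = norm b"
  obtains f where "orthogonal_transformation f" "f a = b"
proof -
  define w where "w = a - b"
  define f where "f y = y - (2 * (w \<bullet> y) / (w \<bullet> w)) *\<^sub>R w" for y
  have "linear f"
    by (rule linearI) (simp_all add: f_def inner_add_right algebra_simps add_divide_distrib)
  moreover have "norm (f y) = norm y" for y
  proof (cases "w = 0")
    case False
    then have "f y \<bullet> f y = y \<bullet> y"
      by (simp add: f_def inner_diff_left inner_diff_right inner_commute field_simps power2_eq_square)
    then show ?thesis by (simp add: norm_eq_sqrt_inner)
  qed (simp add: f_def)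
  ultimately have "orthogonal_transformation f" by (simp add: orthogonal_transformation)
  moreover have "f a = b"
  proof (cases "w = 0")
    case False
    have ab: "a \<bullet> a = b \<bullet> b" using assms by (simp add: norm_eq)
    have "2 * (w \<bullet> a) = w \<bullet> w"
      by (simp add: w_def inner_diff_left inner_diff_right inner_commute ab)
    then have "f a = a - w" using False by (simp add: f_def)
    then show ?thesis by (simp add: w_def)
  qed (simp add: f_def w_def)
  ultimately show ?thesis using that by blast
qed

text \<open>On the line at distance \<open>s\<close> from the axis, t = u / sqrt(u^2 + s^2) is the
  cosine of the angle to the axis. Its inverse is u = s t / sqrt(1 - t^2), whose derivative produces
  the third power.\<close>

lemma slice_substitution:
  fixes h :: "real \<Rightarrow> real"
  assumes h[measurable]: "h \<in> borel_measurable borel" and s: "0 < s" "s \<le> 1"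
  shows "(\<integral>\<^sup>+u. ennreal (h (u / sqrt (u\<^sup>2 + s\<^sup>2))) * indicator {u. u\<^sup>2 + s\<^sup>2 \<le> 1} u \<partial>lborel) =
    (\<integral>\<^sup>+t. ennreal (h t * (s / (sqrt (1 - t\<^sup>2)) ^ 3)) * indicator {t. t\<^sup>2 + s\<^sup>2 \<le> 1} t \<partial>lborel)"
proof -
  define b where "b = sqrt (1 - s\<^sup>2)"
  have s2: "s\<^sup>2 \<le> 1" "0 < s\<^sup>2" using s by (auto simp: power_le_one)
  then have b: "b \<ge> 0" "b\<^sup>2 = 1 - s\<^sup>2" by (auto simp: b_def)
  have set_eq: "{t. t\<^sup>2 + s\<^sup>2 \<le> 1} = {-b..b}"
  proof -
    have *: "t\<^sup>2 + s\<^sup>2 \<le> 1 \<longleftrightarrow> \<bar>t\<bar> \<le> b" for t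
    proof -
      have "\<bar>t\<bar> \<le> b \<longleftrightarrow> t\<^sup>2 \<le> 1 - s\<^sup>2"
        using abs_le_square_iff[of t b] unfolding b(2) abs_of_nonneg[OF b(1)] .
      then show ?thesis by linarith
    qed
    show ?thesis unfolding * by (auto simp: abs_le_iff)
  qed
  define g where "g t = s * t / sqrt (1 - t\<^sup>2)" for t
  define g' where "g' t = s / (sqrt (1 - t\<^sup>2)) ^ 3" for t
  have pos: "1 - t\<^sup>2 > 0" if "t \<in> {-b..b}" for t
  proof -
    have "t\<^sup>2 + s\<^sup>2 \<le> 1" using that set_eq by blast
    then show ?thesis using s2 by linarith
  qed
  \<comment> \<open>At the ends of the slice the point lies on the unit sphere, so its cosine equals
    its coordinate: the substitution maps the interval onto itself.\<close>
  have gb: "g b = b" "g (-b) = -b"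
    using b s by (simp_all add: g_def real_sqrt_unique)
  have deriv: "(g has_real_derivative g' t) (at t)" if "t \<in> {-b..b}" for t
  proof -
    let ?r = "sqrt (1 - t\<^sup>2)"
    have r: "?r > 0" "?r\<^sup>2 = 1 - t\<^sup>2" using pos[OF that] by auto
    have "(g has_real_derivative (s * ?r - s * t * (- (2 * t) / (2 * ?r))) / (?r * ?r)) (at t)"
      unfolding g_def using pos[OF that] by (auto intro!: derivative_eq_intros simp: field_simps)
    moreover have "(s * ?r - s * t * (- (2 * t) / (2 * ?r))) / (?r * ?r) = g' t"
    proof -
      have "(s * ?r - s * t * (- (2 * t) / (2 * ?r))) / (?r * ?r) = s * (?r\<^sup>2 + t\<^sup>2) / ?r ^ 3"
        using r(1) by (simp add: field_simps power2_eq_square power3_eq_cube)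
      then show ?thesis using r(2) by (simp add: g'_def)
    qed
    ultimately show ?thesis by simp
  qed
  have cont: "continuous_on {-b..b} g'"
    unfolding g'_def using pos by (intro continuous_intros) force
  have hg: "h (g t / sqrt ((g t)\<^sup>2 + s\<^sup>2)) = h t" if "t \<in> {-b..b}" for t
  proof -
    let ?r = "sqrt (1 - t\<^sup>2)"
    have r: "?r > 0" "?r\<^sup>2 = 1 - t\<^sup>2" using pos[OF that] by auto
    have "(g t)\<^sup>2 + s\<^sup>2 = s\<^sup>2 * (t\<^sup>2 + ?r\<^sup>2) / ?r\<^sup>2"
      using r(1) by (simp add: g_def power_divide power_mult_distrib field_simps)
    also have "\<dots> = (s / ?r)\<^sup>2" using r(2) by (simp add: power_divide)
    finally have "sqrt ((g t)\<^sup>2 + s\<^sup>2) = s / ?r" using r(1) s by simp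
    then show ?thesis using r(1) s by (simp add: g_def)
  qed
  have "(\<integral>\<^sup>+u. ennreal (h (u / sqrt (u\<^sup>2 + s\<^sup>2))) * indicator {-b..b} u \<partial>lborel) =
      (\<integral>\<^sup>+u. ennreal (h (u / sqrt (u\<^sup>2 + s\<^sup>2)) * indicator {g (-b)..g b} u) \<partial>lborel)"
    unfolding gb by (intro nn_integral_cong) (simp add: indicator_def)
  also have "\<dots> = (\<integral>\<^sup>+t. ennreal (h (g t / sqrt ((g t)\<^sup>2 + s\<^sup>2)) * g' t * indicator {-b..b} t) \<partial>lborel)"
  proof (intro nn_integral_substitution deriv cont)
    show "0 \<le> g' t" if "t \<in> {-b..b}" for t
      using pos[OF that] s by (simp add: g'_def)
  qed (use b in \<open>auto simp: set_borel_measurable_def\<close>)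
  also have "\<dots> = (\<integral>\<^sup>+t. ennreal (h t * (s / (sqrt (1 - t\<^sup>2)) ^ 3)) * indicator {-b..b} t \<partial>lborel)"
    by (intro nn_integral_cong) (auto simp: indicator_def hg g'_def)
  finally show ?thesis unfolding set_eq .
qed

section \<open>Slicing the ball along an axis\<close>

abbreviation lborel_PiM :: "'i set \<Rightarrow> ('i \<Rightarrow> real) measure" where
  "lborel_PiM A \<equiv> Pi\<^sub>M A (\<lambda>_. lborel)"

text \<open>Layer cake: the norm is the length of the interval from 0 to \<open>N w\<close>. After
  Fubini the shell between radii r and a has volume proportional to a^m - r^m, which integrates to
  m/(m+1) a^(m+1).\<close>

lemma nn_integral_norm_ball_PiM:
  assumes A: "finite A" and a: "a > 0"
  shows "(\<integral>\<^sup>+w. ennreal (L2_set w A) * indicator {w. L2_set w A \<le> a} w \<partial>lborel_PiM A) =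
    ennreal (unit_ball_vol (real (card A)) * (real (card A) / real (Suc (card A))) * a ^ Suc (card A))"
proof -
  let ?P = "lborel_PiM A" and ?m = "card A"
  define V where "V = unit_ball_vol (real ?m)"
  have V: "V \<ge> 0" by (simp add: V_def)
  interpret product_sigma_finite "\<lambda>_. lborel :: real measure" by standard
  interpret P: finite_product_sigma_finite "\<lambda>_. lborel :: real measure" A by standard (rule A)
  interpret PL: pair_sigma_finite ?P "lborel :: real measure" ..
  define N where "N w = L2_set w A" for w
  have N[measurable]: "N \<in> borel_measurable ?P"
    unfolding N_def L2_set_def using A by measurable
  have N0: "N w \<ge> 0" for w by (simp add: N_def)
  have vol: "emeasure ?P {w \<in> space ?P. N w \<le> r} = ennreal (V * r ^ ?m)" if "r > 0" for r
  proof -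
    have "{w \<in> space ?P. N w \<le> r} = {f. sqrt (\<Sum>i\<in>A. (f i)\<^sup>2) \<le> r} \<inter> space ?P"
      by (auto simp: N_def L2_set_def)
    then show ?thesis using emeasure_cball_aux[OF A that] by (simp add: V_def)
  qed
  have "(\<integral>\<^sup>+w. ennreal (N w) * indicator {w. N w \<le> a} w \<partial>?P) =
      (\<integral>\<^sup>+w. \<integral>\<^sup>+r. indicator {(w, r). 0 < r \<and> r < N w \<and> N w \<le> a} (w, r) \<partial>lborel \<partial>?P)"
  proof (rule nn_integral_cong)
    fix w
    have "(\<integral>\<^sup>+r. indicator {(w, r). 0 < r \<and> r < N w \<and> N w \<le> a} (w, r) \<partial>lborel) =
        (\<integral>\<^sup>+r. indicator {w. N w \<le> a} w * indicator {0<..<N w} r \<partial>lborel)"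
      by (intro nn_integral_cong) (auto simp: indicator_def)
    also have "\<dots> = indicator {w. N w \<le> a} w * ennreal (N w)"
      using N0[of w] by (subst nn_integral_cmult) auto
    finally show "ennreal (N w) * indicator {w. N w \<le> a} w =
        (\<integral>\<^sup>+r. indicator {(w, r). 0 < r \<and> r < N w \<and> N w \<le> a} (w, r) \<partial>lborel)"
      by (simp add: mult.commute)
  qed
  also have "\<dots> = (\<integral>\<^sup>+r. \<integral>\<^sup>+w. indicator {(w, r). 0 < r \<and> r < N w \<and> N w \<le> a} (w, r) \<partial>?P \<partial>lborel)"
    by (rule PL.Fubini'[symmetric]) measurable
  also have "\<dots> = (\<integral>\<^sup>+r. ennreal (V * (a ^ ?m - r ^ ?m)) * indicator {0..a} r \<partial>lborel)"
  proof (rule nn_integral_cong_AE)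
    \<comment> \<open>At r = 0 the two sides may differ: the strict inequality empties the left set
      while the right side is the full ball volume.\<close>
    have "AE r in lborel. r \<noteq> (0::real)" by (rule AE_lborel_singleton)
    then show "AE r in lborel. (\<integral>\<^sup>+w. indicator {(w, r). 0 < r \<and> r < N w \<and> N w \<le> a} (w, r) \<partial>?P) =
        ennreal (V * (a ^ ?m - r ^ ?m)) * indicator {0..a} r"
    proof eventually_elim
      case (elim r)
      show ?case
      proof (cases "0 < r \<and> r \<le> a")
        case True
        have "(\<integral>\<^sup>+w. indicator {(w, r). 0 < r \<and> r < N w \<and> N w \<le> a} (w, r) \<partial>?P) =
            (\<integral>\<^sup>+w. indicator ({w \<in> space ?P. N w \<le> a} - {w \<in> space ?P. N w \<le> r}) w \<partial>?P)"
          using True by (intro nn_integral_cong) (auto simp: indicator_def)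
        also have "\<dots> = emeasure ?P ({w \<in> space ?P. N w \<le> a} - {w \<in> space ?P. N w \<le> r})"
          by (intro nn_integral_indicator) measurable
        also have "\<dots> = emeasure ?P {w \<in> space ?P. N w \<le> a} - emeasure ?P {w \<in> space ?P. N w \<le> r}"
          using True vol[of r] by (intro emeasure_Diff) auto
        also have "\<dots> = ennreal (V * (a ^ ?m - r ^ ?m))"
          using True a V by (simp add: vol ennreal_minus right_diff_distrib)
        finally show ?thesis using True by simp
      next
        case False
        then have "(\<integral>\<^sup>+w. indicator {(w, r). 0 < r \<and> r < N w \<and> N w \<le> a} (w, r) \<partial>?P) = (\<integral>\<^sup>+w. 0 \<partial>?P)"
          by (intro nn_integral_cong) (auto simp: indicator_def)
        then show ?thesis using False elim by (auto simp: indicator_def)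
      qed
    qed
  qed
  also have "\<dots> = ennreal (V * (a ^ ?m * a - a ^ Suc ?m / real (Suc ?m)) - V * (a ^ ?m * 0 - 0 ^ Suc ?m / real (Suc ?m)))"
  proof (rule nn_integral_FTC_Icc[where F = "\<lambda>r. V * (a ^ ?m * r - r ^ Suc ?m / real (Suc ?m))"])
    fix r assume r: "r \<in> {0..a}"
    have d: "((\<lambda>r. r ^ Suc ?m) has_real_derivative real (Suc ?m) * r ^ ?m) (at r)"
      using DERIV_pow[of "Suc ?m" r UNIV] by (simp del: power_Suc)
    show "((\<lambda>r. V * (a ^ ?m * r - r ^ Suc ?m / real (Suc ?m))) has_real_derivative
        V * (a ^ ?m - r ^ ?m)) (at r)"
      using DERIV_cmult[OF DERIV_diff[OF DERIV_cmult_Id[of "a ^ ?m"] DERIV_cdivide[OF d, of "real (Suc ?m)"]], of V]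
      by (simp del: power_Suc)
    show "0 \<le> V * (a ^ ?m - r ^ ?m)"
      using r V by (auto intro!: mult_nonneg_nonneg power_mono)
  qed (use a in auto)
  also have "V * (a ^ ?m * a - a ^ Suc ?m / real (Suc ?m)) - V * (a ^ ?m * 0 - 0 ^ Suc ?m / real (Suc ?m))
      = V * (real ?m / real (Suc ?m)) * a ^ Suc ?m"
    by (simp add: field_simps)
  finally show ?thesis by (simp add: N_def V_def)
qed

lemma AE_PiM_L2_set_nonzero:
  assumes A: "finite A" "A \<noteq> {}"
  shows "AE w in lborel_PiM A. L2_set w A \<noteq> 0"
proof (rule AE_I)
  interpret product_sigma_finite "\<lambda>_. lborel :: real measure" by standard
  show "{w \<in> space (lborel_PiM A). \<not> L2_set w A \<noteq> 0} \<subseteq> (\<Pi>\<^sub>E i\<in>A. {0})"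
    using A by (auto simp: L2_set_eq_0_iff space_PiM PiE_iff intro!: extensionalityI[of _ A])
  show "emeasure (lborel_PiM A) (\<Pi>\<^sub>E i\<in>A. {0}) = 0"
    using A by (subst emeasure_PiM) (auto simp: card_gt_0_iff)
  show "(\<Pi>\<^sub>E i\<in>A. {0}) \<in> sets (lborel_PiM A)"
    using A by (intro sets_PiM_I_finite) auto
qed

text \<open>\<open>real m * unit_ball_vol (real m)\<close> is the area of the unit sphere of R^m;
  the division by \<open>Suc m\<close> is compensated by the dimension factor of the cone
  measure.\<close>

definition cap_const :: "nat \<Rightarrow> real" where
  "cap_const m = unit_ball_vol (real m) * (real m / real (Suc m))"

lemma cap_const_pos: "m > 0 \<Longrightarrow> cap_const m > 0"
  by (simp add: cap_const_def)

text \<open>The radial integral contributes the power m + 1 of sqrt(1 - t^2), the substitution the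
  power -3; together they are the Funk-Hecke weight.\<close>

lemma sqrt_power_div:
  assumes "x > 0" "m > 0"
  shows "sqrt x ^ Suc m / sqrt x ^ 3 = x powr (real m / 2 - 1)"
proof -
  have "sqrt x ^ k = x powr (real k / 2)" for k
    using assms by (simp add: powr_half_sqrt[symmetric] powr_power)
  then have "sqrt x ^ Suc m / sqrt x ^ 3 = x powr (real (Suc m) / 2) / x powr (real 3 / 2)" by metis
  also have "\<dots> = x powr (real (Suc m) / 2 - real 3 / 2)" by (simp add: powr_diff)
  also have "real (Suc m) / 2 - real 3 / 2 = real m / 2 - 1" by (simp add: field_simps)
  finally show ?thesis .
qed

text \<open>Write y as u times \<open>e\<close> plus an orthogonal part w. For fixed w replace u by
  the cosine t; after exchanging the integrals, w runs over a ball of radius sqrt(1 - t^2), and the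
  integrand is proportional to the norm of w.\<close>

lemma cone_integral_Basis:
  fixes e :: "'a::euclidean_space" and h :: "real \<Rightarrow> real"
  assumes e: "e \<in> Basis" and dim: "DIM('a) \<ge> 2"
    and h[measurable]: "h \<in> borel_measurable borel" and h0: "\<And>t. h t \<ge> 0"
  shows "(\<integral>\<^sup>+y. ennreal (h (e \<bullet> y / norm y)) * indicator (cball 0 1) y \<partial>lborel) =
    ennreal (cap_const (DIM('a) - 1)) *
      (\<integral>\<^sup>+t. ennreal (h t * (1 - t\<^sup>2) powr (real (DIM('a) - 1) / 2 - 1)) * indicator {-1<..<1} t \<partial>lborel)"
proof -
  define A where "A = Basis - {e}"
  define m where "m = card A"
  have A: "finite A" "e \<notin> A" "insert e A = Basis" using e by (auto simp: A_def)
  have m: "m = DIM('a) - 1" "m > 0" using e dim by (auto simp: m_def A_def card_Diff_singleton)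
  \<comment> \<open>Dimension at least 2 leaves an orthogonal direction, so w is nonzero almost
    everywhere and the slice substitution applies.\<close>
  then have Ane: "A \<noteq> {}" by (auto simp: m_def)
  interpret product_sigma_finite "\<lambda>_. lborel :: real measure" by standard
  interpret P: finite_product_sigma_finite "\<lambda>_. lborel :: real measure" A by standard (rule A)
  interpret PL: pair_sigma_finite "lborel_PiM A" "lborel :: real measure" ..
  define N where "N w = L2_set w A" for w
  have N[measurable]: "N \<in> borel_measurable (lborel_PiM A)"
    unfolding N_def L2_set_def using A by measurable
  have N0: "N w \<ge> 0" for w by (simp add: N_def)
  define G where "G y = ennreal (h (e \<bullet> y / norm y)) * indicator (cball 0 1) y" for y :: 'a
  have [measurable]: "cball 0 1 \<in> sets (borel :: 'a measure)" by simp
  have [measurable]: "G \<in> borel_measurable borel" unfolding G_def by measurable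
  have Geq: "G (\<Sum>b\<in>Basis. (w(e := u)) b *\<^sub>R b) =
      ennreal (h (u / sqrt (u\<^sup>2 + (N w)\<^sup>2))) * indicator {u. u\<^sup>2 + (N w)\<^sup>2 \<le> 1} u" for w u
  proof -
    define y where "y = (\<Sum>b\<in>Basis. (w(e := u)) b *\<^sub>R b)"
    have c: "y \<bullet> b = (w(e := u)) b" if "b \<in> Basis" for b
      unfolding y_def by (rule inner_sum_left_Basis[OF that])
    have "(norm y)\<^sup>2 = (\<Sum>b\<in>Basis. ((w(e := u)) b)\<^sup>2)"
      unfolding power2_norm_eq_inner euclidean_inner[of y y]
      by (intro sum.cong refl) (simp only: c power2_eq_square)
    also have "\<dots> = u\<^sup>2 + (\<Sum>b\<in>A. ((w(e := u)) b)\<^sup>2)"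
      unfolding A(3)[symmetric] using A(1,2) by simp
    also have "(\<Sum>b\<in>A. ((w(e := u)) b)\<^sup>2) = (\<Sum>b\<in>A. (w b)\<^sup>2)"
      using A by (intro sum.cong) auto
    also have "\<dots> = (N w)\<^sup>2" by (simp add: N_def L2_set_def sum_nonneg)
    finally have n2: "(norm y)\<^sup>2 = u\<^sup>2 + (N w)\<^sup>2" .
    then have n: "norm y = sqrt (u\<^sup>2 + (N w)\<^sup>2)" by (metis norm_ge_zero real_sqrt_unique)
    have "e \<bullet> y = u" using c[OF e] by (simp add: inner_commute)
    then show ?thesis unfolding y_def[symmetric] G_def by (simp add: indicator_def n)
  qed
  have "(\<integral>\<^sup>+y. G y \<partial>lborel) = (\<integral>\<^sup>+f. G (\<Sum>b\<in>Basis. f b *\<^sub>R b) \<partial>lborel_PiM Basis)"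
    by (subst lborel_eq) (simp add: nn_integral_distr)
  also have "\<dots> = (\<integral>\<^sup>+w. \<integral>\<^sup>+u. G (\<Sum>b\<in>Basis. (w(e := u)) b *\<^sub>R b) \<partial>lborel \<partial>lborel_PiM A)"
    using product_nn_integral_insert[OF A(1,2), of "\<lambda>f. G (\<Sum>b\<in>Basis. f b *\<^sub>R b)"] A by simp
  also have "\<dots> = (\<integral>\<^sup>+w. \<integral>\<^sup>+t. ennreal (h t * (N w / sqrt (1 - t\<^sup>2) ^ 3)) *
      indicator {t. t\<^sup>2 + (N w)\<^sup>2 \<le> 1} t \<partial>lborel \<partial>lborel_PiM A)"
  proof (rule nn_integral_cong_AE)
    show "AE w in lborel_PiM A. (\<integral>\<^sup>+u. G (\<Sum>b\<in>Basis. (w(e := u)) b *\<^sub>R b) \<partial>lborel) =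
      (\<integral>\<^sup>+t. ennreal (h t * (N w / sqrt (1 - t\<^sup>2) ^ 3)) * indicator {t. t\<^sup>2 + (N w)\<^sup>2 \<le> 1} t \<partial>lborel)"
      using AE_PiM_L2_set_nonzero[OF A(1) Ane]
    proof eventually_elim
      case (elim w)
      then have Npos: "N w > 0" using N0[of w] by (simp add: N_def less_le)
      show ?case
      proof (cases "N w \<le> 1")
        case True
        then show ?thesis unfolding Geq using slice_substitution[OF h Npos] by simp
      next
        case False
        then have "1 < (N w)\<^sup>2" by (simp add: power2_eq_square less_1_mult)
        then have "\<not> t\<^sup>2 + (N w)\<^sup>2 \<le> 1" for t using zero_le_power2[of t] by linarith
        then show ?thesis unfolding Geq by simp
      qed
    qed
  qed
  also have "\<dots> = (\<integral>\<^sup>+t. \<integral>\<^sup>+w. ennreal (h t * (N w / sqrt (1 - t\<^sup>2) ^ 3)) *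
      indicator {t. t\<^sup>2 + (N w)\<^sup>2 \<le> 1} t \<partial>lborel_PiM A \<partial>lborel)"
    unfolding indicator_def mem_Collect_eq by (rule PL.Fubini'[symmetric]) measurable
  also have "\<dots> = (\<integral>\<^sup>+t. ennreal (cap_const m) *
      (ennreal (h t * (1 - t\<^sup>2) powr (real m / 2 - 1)) * indicator {-1<..<1} t) \<partial>lborel)"
  proof (rule nn_integral_cong_AE)
    have "AE t in lborel. t \<notin> {-1, 1 :: real}"
      by (intro AE_not_in countable_imp_null_set_lborel) auto
    then show "AE t in lborel. (\<integral>\<^sup>+w. ennreal (h t * (N w / sqrt (1 - t\<^sup>2) ^ 3)) *
      indicator {t. t\<^sup>2 + (N w)\<^sup>2 \<le> 1} t \<partial>lborel_PiM A) = ennreal (cap_const m) *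
      (ennreal (h t * (1 - t\<^sup>2) powr (real m / 2 - 1)) * indicator {-1<..<1} t)"
    proof eventually_elim
      case (elim t)
      show ?case
      proof (cases "t \<in> {-1<..<1}")
        case True
        then have "\<bar>t\<bar> < 1" by auto
        then have t2: "1 - t\<^sup>2 > 0" by (simp add: abs_square_less_1)
        define a where "a = sqrt (1 - t\<^sup>2)"
        have a: "a > 0" "a\<^sup>2 = 1 - t\<^sup>2" using t2 by (auto simp: a_def)
        have e: "ennreal (h t * (N w / a ^ 3)) = ennreal (h t / a ^ 3) * ennreal (N w)" for w
          using N0[of w] by (subst ennreal_mult''[symmetric]) simp_all
        have "t\<^sup>2 + (N w)\<^sup>2 \<le> 1 \<longleftrightarrow> N w \<le> a" for w
        proof -
          have "N w \<le> a \<longleftrightarrow> (N w)\<^sup>2 \<le> a\<^sup>2" using a(1) N0[of w] by (simp add: power_mono_iff)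
          then show ?thesis using a(2) by linarith
        qed
        then have "(\<integral>\<^sup>+w. ennreal (h t * (N w / a ^ 3)) * indicator {t. t\<^sup>2 + (N w)\<^sup>2 \<le> 1} t \<partial>lborel_PiM A) =
            (\<integral>\<^sup>+w. ennreal (h t / a ^ 3) * (ennreal (N w) * indicator {w. N w \<le> a} w) \<partial>lborel_PiM A)"
          unfolding e by (intro nn_integral_cong) (simp add: indicator_def)
        also have "\<dots> = ennreal (h t / a ^ 3) * ennreal (cap_const m * a ^ Suc m)"
          using nn_integral_norm_ball_PiM[OF A(1) a(1)]
          by (subst nn_integral_cmult) (simp_all add: N_def[symmetric] cap_const_def m_def)
        also have "\<dots> = ennreal (cap_const m * (h t * (a ^ Suc m / a ^ 3)))"
          using h0[of t] a(1) by (subst ennreal_mult''[symmetric]) (simp_all add: cap_const_def field_simps)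
        also have "\<dots> = ennreal (cap_const m) * ennreal (h t * (1 - t\<^sup>2) powr (real m / 2 - 1))"
          using h0[of t] unfolding a_def sqrt_power_div[OF t2 m(2)]
          by (subst ennreal_mult''[symmetric]) auto
        finally show ?thesis using True by (simp add: a_def)
      next
        case False
        then have "\<not> \<bar>t\<bar> \<le> 1" using elim by auto
        then have "t\<^sup>2 > 1" using abs_square_le_1[of t] by simp
        then have "\<not> t\<^sup>2 + (N w)\<^sup>2 \<le> 1" for w using zero_le_power2[of "N w"] by linarith
        then show ?thesis using False by simp
      qed
    qed
  qed
  also have "\<dots> = ennreal (cap_const m) *
      (\<integral>\<^sup>+t. ennreal (h t * (1 - t\<^sup>2) powr (real m / 2 - 1)) * indicator {-1<..<1} t \<partial>lborel)"
    by (rule nn_integral_cmult) measurable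
  finally show ?thesis unfolding G_def m(1) .
qed

text \<open>A rotation taking \<open>x\<close> to a basis vector preserves Lebesgue measure; the
  origin and the unit sphere are null sets, so the punctured open ball and the closed ball give the
  same integral.\<close>

lemma cone_integral:
  fixes x :: "'a::euclidean_space" and h :: "real \<Rightarrow> real"
  assumes x: "x \<in> sphere 0 1" and dim: "DIM('a) \<ge> 2"
    and h[measurable]: "h \<in> borel_measurable borel" and h0: "\<And>t. h t \<ge> 0"
  shows "(\<integral>\<^sup>+y. ennreal (h (x \<bullet> y / norm y)) * indicator (ball 0 1 - {0}) y \<partial>lborel) =
    ennreal (cap_const (DIM('a) - 1)) *
      (\<integral>\<^sup>+t. ennreal (h t * (1 - t\<^sup>2) powr (real (DIM('a) - 1) / 2 - 1)) * indicator {-1<..<1} t \<partial>lborel)"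
proof -
  obtain e :: 'a where e: "e \<in> Basis" using nonempty_Basis by blast
  obtain f :: "'a \<Rightarrow> 'a" where f: "orthogonal_transformation f" "f x = e"
    using orthogonal_transformation_between[of x e] x e by auto
  then have lin: "linear f" and nf: "\<And>y. norm (f y) = norm y"
    by (auto simp: orthogonal_transformation)
  have inf: "f y \<bullet> f z = y \<bullet> z" for y z
    using f(1) by (simp add: orthogonal_transformation_def)
  have [measurable]: "f \<in> borel_measurable borel"
    by (intro borel_measurable_continuous_onI linear_continuous_on linear_conv_bounded_linear[THEN iffD1] lin)
  have [measurable]: "cball 0 1 \<in> sets (borel :: 'a measure)" by simp
  have "sphere 0 1 \<in> null_sets (lborel :: 'a measure)"
    using negligible_sphere[of "0::'a" 1] by (simp add: negligible_iff_null_sets null_sets_completion_iff)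
  then have "AE y in lborel. y \<notin> (sphere 0 1 :: 'a set)" by (rule AE_not_in)
  with AE_lborel_singleton[of "0::'a"]
  have "(\<integral>\<^sup>+y. ennreal (h (x \<bullet> y / norm y)) * indicator (ball 0 1 - {0}) y \<partial>lborel) =
      (\<integral>\<^sup>+y. ennreal (h (e \<bullet> f y / norm (f y))) * indicator (cball 0 1) (f y) \<partial>lborel)"
    by (intro nn_integral_cong_AE, eventually_elim)
       (auto simp: f(2)[symmetric] nf inf indicator_def)
  also have "\<dots> = (\<integral>\<^sup>+y. ennreal (h (e \<bullet> y / norm y)) * indicator (cball 0 1) y \<partial>distr lborel borel f)"
    by (simp add: nn_integral_distr)
  also have "\<dots> = (\<integral>\<^sup>+y. ennreal (h (e \<bullet> y / norm y)) * indicator (cball 0 1) y \<partial>lborel)"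
    by (simp only: distr_lborel_orthogonal_transformation[OF f(1)])
  also note cone_integral_Basis[OF e dim h h0]
  finally show ?thesis .
qed

section \<open>The uniform probability measure on the sphere\<close>

definition sphere_prob :: "'a::euclidean_space measure" where
  "sphere_prob = density sphere_surface (\<lambda>_. ennreal (1 / measure (sphere_surface :: 'a measure) (sphere 0 1)))"

lemma sets_sphere_surface: "sets (sphere_surface :: 'a::euclidean_space measure) = sets (restrict_space borel (sphere 0 1))"
  by (simp add: sphere_surface_def)

lemma space_sphere_surface: "space (sphere_surface :: 'a::euclidean_space measure) = sphere 0 1"
  by (simp add: sphere_surface_def space_restrict_space)

lemma sets_sphere_prob: "sets (sphere_prob :: 'a::euclidean_space measure) = sets (restrict_space borel (sphere 0 1))"
  by (simp add: sphere_prob_def sets_sphere_surface)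

lemma space_sphere_prob: "space (sphere_prob :: 'a::euclidean_space measure) = sphere 0 1"
  by (simp add: sphere_prob_def space_sphere_surface)

lemma borel_measurable_sphere_prob:
  "borel_measurable (sphere_prob :: 'a::euclidean_space measure) = borel_measurable (restrict_space borel (sphere 0 1))"
  by (rule measurable_cong_sets) (simp_all add: sets_sphere_prob)

lemma continuous_on_sphere_measurable:
  fixes f :: "'a::euclidean_space \<Rightarrow> 'b::topological_space"
  shows "continuous_on (sphere 0 1) f \<Longrightarrow> f \<in> borel_measurable sphere_prob"
  unfolding borel_measurable_sphere_prob by (rule borel_measurable_continuous_on_restrict)

lemma nn_integral_sphere_surface:
  fixes F :: "'a::euclidean_space \<Rightarrow> ennreal"
  assumes F[measurable]: "F \<in> borel_measurable (restrict_space borel (sphere 0 1))"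
  shows "(\<integral>\<^sup>+y. F y \<partial>sphere_surface) =
    of_nat DIM('a) * (\<integral>\<^sup>+y. F (y /\<^sub>R norm y) * indicator (ball 0 1 - {0}) y \<partial>lborel)"
proof -
  let ?R = "restrict_space (lborel :: 'a measure) (ball 0 1 - {0})"
  let ?S = "restrict_space (borel :: 'a measure) (sphere 0 1)"
  have [measurable]: "(\<lambda>y. y /\<^sub>R norm y) \<in> ?R \<rightarrow>\<^sub>M ?S"
    by (intro measurable_restrict_space2 measurable_restrict_space1) (auto simp: space_restrict_space)
  have "(\<integral>\<^sup>+y. F y \<partial>sphere_surface) = ennreal (real DIM('a)) * (\<integral>\<^sup>+y. F y \<partial>distr ?R ?S (\<lambda>y. y /\<^sub>R norm y))"
    unfolding sphere_surface_def by (simp add: nn_integral_density nn_integral_cmult)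
  also have "(\<integral>\<^sup>+y. F y \<partial>distr ?R ?S (\<lambda>y. y /\<^sub>R norm y)) = (\<integral>\<^sup>+y. F (y /\<^sub>R norm y) \<partial>?R)"
    by (rule nn_integral_distr) measurable
  also have "\<dots> = (\<integral>\<^sup>+y. F (y /\<^sub>R norm y) * indicator (ball 0 1 - {0}) y \<partial>lborel)"
    by (rule nn_integral_restrict_space) simp
  finally show ?thesis by (simp add: ennreal_of_nat_eq_real_of_nat)
qed

lemma emeasure_sphere_surface:
  "emeasure (sphere_surface :: 'a::euclidean_space measure) (sphere 0 1) =
    ennreal (real DIM('a) * unit_ball_vol (real DIM('a)))"
proof -
  have "emeasure (sphere_surface :: 'a measure) (sphere 0 1) = (\<integral>\<^sup>+y. 1 \<partial>(sphere_surface :: 'a measure))"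
    by (simp flip: space_sphere_surface)
  also have "\<dots> = of_nat DIM('a) * emeasure lborel (ball 0 1 - {0 :: 'a})"
    by (subst nn_integral_sphere_surface) auto
  also have "emeasure lborel (ball 0 1 - {0 :: 'a}) = emeasure lborel (ball 0 1 :: 'a set)"
    by (intro emeasure_Diff_null_set) auto
  also have "\<dots> = ennreal (unit_ball_vol (real DIM('a)))"
    by (simp add: emeasure_ball)
  finally show ?thesis by (simp add: ennreal_of_nat_eq_real_of_nat ennreal_mult')
qed

lemma measure_sphere_surface_pos: "measure (sphere_surface :: 'a::euclidean_space measure) (sphere 0 1) > 0"
  by (simp add: measure_def emeasure_sphere_surface)

lemma prob_space_sphere_prob: "prob_space (sphere_prob :: 'a::euclidean_space measure)"
proof
  let ?S = "sphere_surface :: 'a measure"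
  have "emeasure sphere_prob (space (sphere_prob :: 'a measure)) = (\<integral>\<^sup>+y. ennreal (1 / measure ?S (sphere 0 1)) \<partial>?S)"
    unfolding sphere_prob_def by (simp add: emeasure_density nn_integral_indicator cong: nn_integral_cong)
  also have "\<dots> = ennreal (1 / measure ?S (sphere 0 1)) * emeasure ?S (sphere 0 1)"
    by (simp add: space_sphere_surface)
  also have "emeasure ?S (sphere 0 1) = ennreal (measure ?S (sphere 0 1))"
    by (simp add: measure_def emeasure_sphere_surface)
  finally show "emeasure sphere_prob (space (sphere_prob :: 'a measure)) = 1"
    using measure_sphere_surface_pos[where 'a='a] by (simp flip: ennreal_mult')
qed

lemma sphere_avg_eq_integral:
  assumes "f \<in> borel_measurable sphere_prob"
  shows "sphere_avg f = (LINT y|sphere_prob. f y)"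
proof -
  have "f \<in> borel_measurable sphere_surface"
    using assms by (simp add: sphere_prob_def)
  then have "(LINT y|sphere_prob. f y) =
      (LINT y|sphere_surface. (1 / measure (sphere_surface :: 'a measure) (sphere 0 1)) *\<^sub>R f y)"
    unfolding sphere_prob_def by (subst integral_density) auto
  then show ?thesis by (simp add: sphere_avg_def)
qed

text \<open>Here \<open>n\<close> is the ambient dimension, so \<open>n - 1\<close> is the dimension
  of the sphere. Up to normalisation this is the density of the inner product of a fixed unit vector
  with a uniform point.\<close>

abbreviation weight :: "nat \<Rightarrow> real \<Rightarrow> real" where
  "weight n t \<equiv> (1 - t\<^sup>2) powr (real (n - 1) / 2 - 1)"

lemma einterval_minus_1_1: "einterval (-1) 1 = {-1<..<1}"
  using einterval_eq(1)[of "-1" 1] by (simp add: one_ereal_def)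

lemma interval_integral_eq_LINT:
  fixes f :: "real \<Rightarrow> real"
  shows "(LBINT t=-1..1. f t) = (LINT t|lborel. f t * indicator {-1<..<1} t)"
proof -
  have "(-1 :: ereal) \<le> 1" by (simp add: one_ereal_def)
  then show ?thesis
    by (simp add: interval_lebesgue_integral_def einterval_minus_1_1 set_lebesgue_integral_def mult.commute)
qed

text \<open>\<open>K\<close> is chosen before the vector and the function; a constant function can
  therefore identify it later.\<close>

lemma nn_integral_sphere_prob_inner:
  assumes dim: "DIM('a::euclidean_space) \<ge> 2"
  shows "\<exists>K>0. \<forall>(x::'a) h. x \<in> sphere 0 1 \<longrightarrow> h \<in> borel_measurable borel \<longrightarrow> (\<forall>t. h t \<ge> 0) \<longrightarrow>
    (\<integral>\<^sup>+y. ennreal (h (x \<bullet> y)) \<partial>sphere_prob) =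
      ennreal K * (\<integral>\<^sup>+t. ennreal (h t * weight DIM('a) t * indicator {-1<..<1} t) \<partial>lborel)"
proof -
  let ?w = "measure (sphere_surface :: 'a measure) (sphere 0 1)"
  let ?K = "1 / ?w * (real DIM('a) * cap_const (DIM('a) - 1))"
  have cp: "cap_const (DIM('a) - 1) > 0" using dim by (intro cap_const_pos) auto
  have K: "?K > 0" using measure_sphere_surface_pos[where 'a='a] cp by simp
  have KK: "ennreal ?K = ennreal (1 / ?w) * (of_nat DIM('a) * ennreal (cap_const (DIM('a) - 1)))"
  proof -
    have "ennreal ?K = ennreal (1 / ?w) * ennreal (real DIM('a) * cap_const (DIM('a) - 1))"
      by (rule ennreal_mult') simp
    also have "ennreal (real DIM('a) * cap_const (DIM('a) - 1)) = of_nat DIM('a) * ennreal (cap_const (DIM('a) - 1))"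
      unfolding ennreal_of_nat_eq_real_of_nat by (rule ennreal_mult') simp
    finally show ?thesis .
  qed
  have "(\<integral>\<^sup>+y. ennreal (h (x \<bullet> y)) \<partial>sphere_prob) =
      ennreal ?K * (\<integral>\<^sup>+t. ennreal (h t * weight DIM('a) t * indicator {-1<..<1} t) \<partial>lborel)"
    if x: "x \<in> sphere 0 1" and h[measurable]: "h \<in> borel_measurable borel" and h0: "\<And>t. h t \<ge> 0"
    for x :: 'a and h :: "real \<Rightarrow> real"
  proof -
    have hx[measurable]: "(\<lambda>y. ennreal (h (x \<bullet> y))) \<in> borel_measurable (restrict_space borel (sphere 0 1))"
      by (intro measurable_restrict_space1) measurable
    then have [measurable]: "(\<lambda>y. ennreal (h (x \<bullet> y))) \<in> borel_measurable sphere_surface"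
      by (simp add: measurable_cong_sets[OF sets_sphere_surface refl])
    have "(\<integral>\<^sup>+y. ennreal (h (x \<bullet> y)) \<partial>sphere_prob) = ennreal (1 / ?w) * (\<integral>\<^sup>+y. ennreal (h (x \<bullet> y)) \<partial>sphere_surface)"
      unfolding sphere_prob_def by (simp add: nn_integral_density nn_integral_cmult)
    also have "(\<integral>\<^sup>+y. ennreal (h (x \<bullet> y)) \<partial>sphere_surface) = of_nat DIM('a) *
        (\<integral>\<^sup>+y. ennreal (h (x \<bullet> y / norm y)) * indicator (ball 0 1 - {0}) y \<partial>lborel)"
      by (subst nn_integral_sphere_surface[OF hx]) (simp add: divide_inverse mult.commute)
    also have "(\<integral>\<^sup>+y. ennreal (h (x \<bullet> y / norm y)) * indicator (ball 0 1 - {0}) y \<partial>lborel) =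
        ennreal (cap_const (DIM('a) - 1)) *
        (\<integral>\<^sup>+t. ennreal (h t * weight DIM('a) t) * indicator {-1<..<1} t \<partial>lborel)"
      by (rule cone_integral[OF x dim h h0])
    also have "(\<integral>\<^sup>+t. ennreal (h t * weight DIM('a) t) * indicator {-1<..<1} t \<partial>lborel) =
        (\<integral>\<^sup>+t. ennreal (h t * weight DIM('a) t * indicator {-1<..<1} t) \<partial>lborel)"
      by (intro nn_integral_cong) (auto simp: indicator_def)
    finally show ?thesis
      by (simp only: KK mult.assoc)
  qed
  with K show ?thesis by blast
qed

text \<open>In ambient dimension 2 the exponent is -1/2 and the weight is unbounded at both ends.
  Finiteness is read off from the total mass 1 of \<open>sphere_prob\<close>.\<close>

lemma integrable_weight:
  assumes dim: "DIM('a::euclidean_space) \<ge> 2"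
  shows "integrable lborel (\<lambda>t. weight DIM('a) t * indicator {-1<..<1} t)"
proof -
  interpret prob_space "sphere_prob :: 'a measure" by (rule prob_space_sphere_prob)
  obtain e :: 'a where e: "e \<in> Basis" using nonempty_Basis by blast
  obtain K where K: "K > 0" and *: "\<And>(x::'a) h. x \<in> sphere 0 1 \<Longrightarrow> h \<in> borel_measurable borel \<Longrightarrow> (\<And>t. h t \<ge> 0) \<Longrightarrow>
    (\<integral>\<^sup>+y. ennreal (h (x \<bullet> y)) \<partial>sphere_prob) =
      ennreal K * (\<integral>\<^sup>+t. ennreal (h t * weight DIM('a) t * indicator {-1<..<1} t) \<partial>lborel)"
    using nn_integral_sphere_prob_inner[OF dim] by blast
  have "ennreal K * (\<integral>\<^sup>+t. ennreal (1 * weight DIM('a) t * indicator {-1<..<1} t) \<partial>lborel) = 1"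
    using *[of e "\<lambda>_. 1"] e emeasure_space_1 by simp
  then have "(\<integral>\<^sup>+t. ennreal (weight DIM('a) t * indicator {-1<..<1} t) \<partial>lborel) \<noteq> \<top>"
    using K by (auto simp: ennreal_mult_eq_top_iff)
  then show ?thesis
    by (intro integrableI_nonneg) (auto simp: less_top)
qed

lemma integral_sphere_prob_inner:
  fixes x :: "'a::euclidean_space"
  assumes dim: "DIM('a) \<ge> 2" and x: "x \<in> sphere 0 1"
    and h[measurable]: "h \<in> borel_measurable borel" and h0: "\<And>t. h t \<ge> 0"
  shows "(LINT y|sphere_prob. h (x \<bullet> y)) =
    (LBINT t=-1..1. h t * weight DIM('a) t) / (LBINT t=-1..1. weight DIM('a) t)"
proof -
  interpret prob_space "sphere_prob :: 'a measure" by (rule prob_space_sphere_prob)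
  obtain K where K: "K > 0" and *: "\<And>(x::'a) h. x \<in> sphere 0 1 \<Longrightarrow> h \<in> borel_measurable borel \<Longrightarrow> (\<And>t. h t \<ge> 0) \<Longrightarrow>
    (\<integral>\<^sup>+y. ennreal (h (x \<bullet> y)) \<partial>sphere_prob) =
      ennreal K * (\<integral>\<^sup>+t. ennreal (h t * weight DIM('a) t * indicator {-1<..<1} t) \<partial>lborel)"
    using nn_integral_sphere_prob_inner[OF dim] by blast
  have L: "(LINT y|sphere_prob. h (x \<bullet> y)) = K * (LBINT t=-1..1. h t * weight DIM('a) t)"
    if [measurable]: "h \<in> borel_measurable borel" and h0: "\<And>t. h t \<ge> 0" for h
  proof -
    have [measurable]: "(\<lambda>y. h (x \<bullet> y)) \<in> borel_measurable (sphere_prob :: 'a measure)"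
      unfolding borel_measurable_sphere_prob by (intro measurable_restrict_space1) measurable
    have "(LINT y|sphere_prob. h (x \<bullet> y)) = enn2real (\<integral>\<^sup>+y. ennreal (h (x \<bullet> y)) \<partial>sphere_prob)"
      using h0 by (intro integral_eq_nn_integral) auto
    also have "\<dots> = K * enn2real (\<integral>\<^sup>+t. ennreal (h t * weight DIM('a) t * indicator {-1<..<1} t) \<partial>lborel)"
      using K by (subst *[OF x that]) (simp add: enn2real_mult)
    also have "enn2real (\<integral>\<^sup>+t. ennreal (h t * weight DIM('a) t * indicator {-1<..<1} t) \<partial>lborel) =
        (LINT t|lborel. h t * weight DIM('a) t * indicator {-1<..<1} t)"
      using h0 by (intro integral_eq_nn_integral[symmetric]) auto
    finally show ?thesis by (simp add: interval_integral_eq_LINT)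
  qed
  \<comment> \<open>Testing with the constant function 1 determines the normalisation.\<close>
  have "K * (LBINT t=-1..1. weight DIM('a) t) = 1"
    using L[of "\<lambda>_. 1"] by (simp add: prob_space)
  moreover have "K = 1 / W" if "K * W = 1" for W
    using that by (cases "W = 0") (auto simp: field_simps)
  ultimately have "K = 1 / (LBINT t=-1..1. weight DIM('a) t)" by blast
  then show ?thesis using L[OF h h0] by simp
qed

section \<open>Large deviations from Gaussian moment generating functions\<close>

definition quad_form :: "('m::finite \<Rightarrow> 'm \<Rightarrow> real) \<Rightarrow> real^'m \<Rightarrow> real" where
  "quad_form B \<theta> = (\<Sum>i\<in>UNIV. \<Sum>j\<in>UNIV. \<theta> $ i * B i j * \<theta> $ j)"

lemma rate2_quad_form: "rate2 B y = (SUP \<theta>. ereal (\<theta> \<bullet> y - 1/2 * quad_form B \<theta>))"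
  by (simp add: rate2_def quad_form_def)

lemma rate2_ge: "ereal (\<theta> \<bullet> y - 1/2 * quad_form B \<theta>) \<le> rate2 B y"
  unfolding rate2_quad_form by (rule SUP_upper) simp

lemma quad_form_0 [simp]: "quad_form B 0 = 0"
  by (simp add: quad_form_def)

lemma rate2_nonneg: "0 \<le> rate2 B y"
  using rate2_ge[of 0 y B] by (simp add: zero_ereal_def)

lemma quad_form_scaleR: "quad_form B (s *\<^sub>R \<theta>) = s\<^sup>2 * quad_form B \<theta>"
  by (simp add: quad_form_def sum_distrib_left power2_eq_square mult_ac)

lemma quad_form_eq_inner: "quad_form B \<theta> = (\<Sum>i\<in>UNIV. \<theta> $ i * (\<Sum>j\<in>UNIV. B i j * \<theta> $ j))"
  by (simp add: quad_form_def sum_distrib_left mult_ac)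

lemma sum_axis_mult:
  fixes f :: "'m::finite \<Rightarrow> real"
  shows "(\<Sum>k\<in>UNIV. axis i s $ k * f k) = s * f i"
  by (subst sum.remove[of _ i]) (auto simp: axis_def intro!: sum.neutral)

lemma sum_mult_axis:
  fixes f :: "'m::finite \<Rightarrow> real"
  shows "(\<Sum>k\<in>UNIV. f k * axis i s $ k) = s * f i"
  using sum_axis_mult[of i s f] by (simp add: mult.commute)

lemma quad_form_axis: "quad_form B (axis i s) = s\<^sup>2 * B i i"
  by (simp add: quad_form_eq_inner sum_axis_mult sum_mult_axis power2_eq_square)

lemma quad_form_add_axis:
  assumes "\<And>i j. B i j = B j i"
  shows "quad_form B (\<theta> + axis i s) =
    quad_form B \<theta> + 2 * s * (\<Sum>j\<in>UNIV. B i j * \<theta> $ j) + s\<^sup>2 * B i i"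
proof -
  have "quad_form B (\<theta> + axis i s) =
    quad_form B \<theta> + (\<Sum>k\<in>UNIV. \<theta> $ k * (\<Sum>j\<in>UNIV. B k j * axis i s $ j))
      + (\<Sum>k\<in>UNIV. axis i s $ k * (\<Sum>j\<in>UNIV. B k j * \<theta> $ j))
      + (\<Sum>k\<in>UNIV. axis i s $ k * (\<Sum>j\<in>UNIV. B k j * axis i s $ j))"
    by (simp add: quad_form_eq_inner algebra_simps sum.distrib)
  also have "(\<Sum>k\<in>UNIV. \<theta> $ k * (\<Sum>j\<in>UNIV. B k j * axis i s $ j)) = s * (\<Sum>j\<in>UNIV. B i j * \<theta> $ j)"
    unfolding sum_mult_axis using assms[of i] by (simp add: sum_distrib_left mult_ac)
  finally show ?thesis
    unfolding sum_mult_axis sum_axis_mult by (simp add: power2_eq_square algebra_simps)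
qed

lemma sublevel_rate2:
  "{y. rate2 B y \<le> ereal a} = (\<Inter>\<theta>. {y. \<theta> \<bullet> y - 1/2 * quad_form B \<theta> \<le> a})"
  by (auto simp: rate2_quad_form SUP_le_iff)

lemma closed_sublevel_rate2: "closed {y. rate2 B y \<le> ereal a}"
  unfolding sublevel_rate2 by (intro closed_INT ballI closed_Collect_le continuous_intros)

text \<open>The signed coordinate vectors as test vectors already confine \<open>y\<close> to a box.
  This gives both the goodness of the rate function and the compact part in the upper bound.\<close>

lemma bounded_axis_halfspaces:
  "bounded {y :: real^'m::finite. \<forall>i. \<forall>s\<in>{-1, 1}. axis i s \<bullet> y - 1/2 * quad_form B (axis i s) \<le> a}"
proof (rule boundedI)
  fix y :: "real^'m"
  assume y: "y \<in> {y. \<forall>i. \<forall>s\<in>{-1, 1}. axis i s \<bullet> y - 1/2 * quad_form B (axis i s) \<le> a}"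
  have "\<bar>y $ i\<bar> \<le> a + 1/2 * B i i" for i
    using y by (auto simp: inner_axis' quad_form_axis abs_le_iff dest: spec[of _ i])
  then have "(\<Sum>i\<in>UNIV. \<bar>y $ i\<bar>) \<le> (\<Sum>i\<in>UNIV. a + 1/2 * B i i)"
    by (intro sum_mono)
  then show "norm y \<le> (\<Sum>i\<in>UNIV. a + 1/2 * B i i)"
    using norm_le_l1_cart[of y] by linarith
qed

lemma good_rate_function_rate2: "good_rate_function (rate2 B)"
  unfolding good_rate_function_def
proof (intro conjI allI)
  fix a :: real
  have "bounded {y. rate2 B y \<le> ereal a}"
    by (rule bounded_subset[OF bounded_axis_halfspaces[of B a]]) (auto simp: sublevel_rate2)
  then show "compact {y. rate2 B y \<le> ereal a}"
    using closed_sublevel_rate2 by (simp add: compact_eq_bounded_closed)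
qed (rule rate2_nonneg)

text \<open>Let z be the component of \<open>y\<close> orthogonal to the range of the matrix. The
  quadratic form vanishes at z, so along multiples of z the supremum grows linearly, and a finite
  rate forces z = 0. A solution \<theta> is the tilting parameter for the lower bound.\<close>

lemma rate2_finite_imp_range:
  fixes B :: "'m::finite \<Rightarrow> 'm \<Rightarrow> real"
  assumes "rate2 B y \<noteq> \<infinity>"
  shows "\<exists>\<theta>. \<forall>i. y $ i = (\<Sum>j\<in>UNIV. B i j * \<theta> $ j)"
proof -
  define A :: "real^'m^'m" where "A = (\<chi> i j. B i j)"
  have A: "(A *v \<theta>) $ i = (\<Sum>j\<in>UNIV. B i j * \<theta> $ j)" for \<theta> i
    by (simp add: A_def matrix_vector_mult_def)
  have sub: "subspace (range ((*v) A))"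
    by (intro linear_subspace_image matrix_vector_mul_linear subspace_UNIV)
  obtain p z where pz: "p \<in> span (range ((*v) A))"
      "\<And>w. w \<in> span (range ((*v) A)) \<Longrightarrow> orthogonal z w" "y = p + z"
    using orthogonal_subspace_decomp_exists[of "range ((*v) A)" y] by metis
  have "z = 0"
  proof (rule ccontr)
    assume "z \<noteq> 0"
    then have zz: "z \<bullet> z > 0" by simp
    have "quad_form B z = z \<bullet> (A *v z)"
      by (simp add: quad_form_eq_inner inner_vec_def A)
    also have "\<dots> = 0" using pz(2)[of "A *v z"] by (simp add: orthogonal_def span_base)
    finally have q: "quad_form B z = 0" .
    have zy: "z \<bullet> y = z \<bullet> z" using pz(2)[OF pz(1)] by (simp add: pz(3) inner_right_distrib orthogonal_def)
    obtain r where r: "rate2 B y = ereal r"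
      using assms rate2_nonneg[of B y] by (cases "rate2 B y") auto
    have "s * (z \<bullet> z) \<le> r" for s
      using rate2_ge[of "s *\<^sub>R z" y B] by (simp add: q zy quad_form_scaleR r)
    from this[of "(r + 1) / (z \<bullet> z)"] show False using zz by simp
  qed
  then have "y \<in> range ((*v) A)" using pz sub by (metis add.right_neutral span_eq_iff)
  then show ?thesis using A by auto
qed

section \<open>Exponential bounds for Gaussian sequences\<close>

lemma eln_upper:
  assumes "w > 0" "p \<le> exp (- w * a)"
  shows "ereal (1 / w) * eln p \<le> ereal (- a)"
proof (cases "p \<le> 0")
  case False
  then have "ln p \<le> - w * a" using assms by (metis linorder_not_less ln_exp ln_le_cancel_iff exp_gt_zero)
  then show ?thesis using False assms by (simp add: eln_def field_simps)
qed (use assms in \<open>simp add: eln_def\<close>)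

lemma eln_lower:
  assumes "w > 0" "p \<ge> exp (- w * a)"
  shows "ereal (1 / w) * eln p \<ge> ereal (- a)"
proof -
  have p: "p > 0" using assms(2) exp_gt_zero[of "- w * a"] by linarith
  then have "ln p \<ge> - w * a" using assms(2) by (metis ln_exp ln_le_cancel_iff exp_gt_zero)
  then show ?thesis using p assms by (simp add: eln_def field_simps)
qed

text \<open>A family of random vectors enters only through its moment generating function, so no density
  is needed and degenerate covariance matrices are covered.\<close>
locale gaussian_sequence =
  fixes M :: "nat \<Rightarrow> 'w measure" and X :: "nat \<Rightarrow> 'w \<Rightarrow> real^'m::finite"
    and V :: "nat \<Rightarrow> 'm \<Rightarrow> 'm \<Rightarrow> real" and v :: "nat \<Rightarrow> real" and B :: "'m \<Rightarrow> 'm \<Rightarrow> real"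
  assumes prob: "\<And>L. L \<ge> 1 \<Longrightarrow> prob_space (M L)"
    and X_measurable: "\<And>L. L \<ge> 1 \<Longrightarrow> X L \<in> borel_measurable (M L)"
    and exp_integrable: "\<And>L \<theta>. L \<ge> 1 \<Longrightarrow> integrable (M L) (\<lambda>\<omega>. exp (\<theta> \<bullet> X L \<omega>))"
    and mgf: "\<And>L \<theta>. L \<ge> 1 \<Longrightarrow> (LINT \<omega>|M L. exp (\<theta> \<bullet> X L \<omega>)) = exp (1/2 * quad_form (V L) \<theta>)"
    and V_sym: "\<And>L i j. V L i j = V L j i"
    and v_top: "filterlim v at_top sequentially"
    and V_lim: "\<And>i j. (\<lambda>L. v L * V L i j) \<longlonglongrightarrow> B i j"
begin

lemma v_pos: "\<forall>\<^sub>F L in sequentially. v L > 0"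
  using v_top by (simp add: filterlim_at_top_dense)

lemma quad_form_lim: "(\<lambda>L. v L * quad_form (V L) \<theta>) \<longlonglongrightarrow> quad_form B \<theta>"
proof -
  have "(\<lambda>L. \<Sum>i\<in>UNIV. \<Sum>j\<in>UNIV. \<theta> $ i * (v L * V L i j) * \<theta> $ j) \<longlonglongrightarrow> quad_form B \<theta>"
    unfolding quad_form_def by (intro tendsto_intros V_lim)
  then show ?thesis by (simp add: quad_form_def sum_distrib_left mult_ac)
qed

text \<open>Absorbs constant prefactors, such as a number of half spaces, into an arbitrarily small
  loss in the exponent.\<close>

lemma exp_mult_eventually_ge:
  assumes "e > 0"
  shows "\<forall>\<^sub>F L in sequentially. exp (v L * e) \<ge> K"
proof -
  have "\<forall>\<^sub>F L in sequentially. v L \<ge> K / e" using v_top by (simp add: filterlim_at_top)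
  then show ?thesis
  proof eventually_elim
    case (elim L)
    then have "K \<le> v L * e" using assms by (simp add: field_simps)
    then show ?case using exp_ge_add_one_self[of "v L * e"] by linarith
  qed
qed

text \<open>Markov's inequality for the exponential with parameter
  \<open>v L *\<^sub>R \<theta>\<close>.\<close>

lemma halfspace_bound:
  assumes L: "L \<ge> 1" and v: "v L \<ge> 0"
  shows "measure (M L) {\<omega> \<in> space (M L). \<theta> \<bullet> X L \<omega> > c} \<le> exp (1/2 * ((v L)\<^sup>2 * quad_form (V L) \<theta>) - v L * c)"
proof -
  interpret prob_space "M L" by (rule prob[OF L])
  note [measurable] = X_measurable[OF L]
  have ee: "exp ((v L *\<^sub>R \<theta>) \<bullet> X L \<omega>) * exp (- v L * c) = exp (v L * (\<theta> \<bullet> X L \<omega> - c))" for \<omega>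
    by (simp add: mult_exp_exp algebra_simps)
  have "measure (M L) {\<omega> \<in> space (M L). \<theta> \<bullet> X L \<omega> > c} =
      (LINT \<omega>|M L. indicator {\<omega> \<in> space (M L). \<theta> \<bullet> X L \<omega> > c} \<omega>)"
    by (simp add: Int_absorb2 subset_eq)
  also have "\<dots> \<le> (LINT \<omega>|M L. exp ((v L *\<^sub>R \<theta>) \<bullet> X L \<omega>) * exp (- v L * c))"
  proof (rule integral_mono)
    show "integrable (M L) (\<lambda>\<omega>. indicator {\<omega> \<in> space (M L). \<theta> \<bullet> X L \<omega> > c} \<omega> :: real)"
      by (simp add: emeasure_finite less_top[symmetric])
    show "integrable (M L) (\<lambda>\<omega>. exp ((v L *\<^sub>R \<theta>) \<bullet> X L \<omega>) * exp (- v L * c))"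
      by (intro integrable_mult_left exp_integrable L)
    show "indicator {\<omega> \<in> space (M L). \<theta> \<bullet> X L \<omega> > c} \<omega> \<le> exp ((v L *\<^sub>R \<theta>) \<bullet> X L \<omega>) * exp (- v L * c)" for \<omega>
      unfolding ee using v by (auto simp: indicator_def intro!: mult_nonneg_nonneg)
  qed
  also have "\<dots> = exp (1/2 * ((v L)\<^sup>2 * quad_form (V L) \<theta>)) * exp (- v L * c)"
    using mgf[OF L, of "v L *\<^sub>R \<theta>"] by (simp add: quad_form_scaleR)
  finally show ?thesis by (simp add: mult_exp_exp)
qed

text \<open>The half spaces along the axes leave only a compact part to cover.\<close>
lemma closed_halfspace_cover:
  fixes C :: "(real^'m) set"
  assumes "closed C" and less: "\<And>y. y \<in> C \<Longrightarrow> ereal a < rate2 B y"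
  shows "\<exists>F. finite F \<and> (\<forall>y\<in>C. \<exists>\<theta>\<in>F. a < \<theta> \<bullet> y - 1/2 * quad_form B \<theta>)"
proof -
  define A where "A = (\<lambda>(i, s). axis i s :: real^'m) ` (UNIV \<times> {-1, 1})"
  define K where "K = C \<inter> {y. \<forall>\<theta>\<in>A. \<theta> \<bullet> y - 1/2 * quad_form B \<theta> \<le> a}"
  have "finite A" by (simp add: A_def)
  have "closed {y. \<forall>\<theta>\<in>A. \<theta> \<bullet> y - 1/2 * quad_form B \<theta> \<le> a}"
    unfolding Ball_def by (intro closed_Collect_all closed_Collect_imp closed_Collect_le continuous_intros) auto
  moreover have "bounded {y. \<forall>\<theta>\<in>A. \<theta> \<bullet> y - 1/2 * quad_form B \<theta> \<le> a}"
    by (rule bounded_subset[OF bounded_axis_halfspaces[of B a]]) (auto simp: A_def)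
  ultimately have "compact K" unfolding K_def using \<open>closed C\<close>
    by (intro closed_Int_compact) (simp_all add: compact_eq_bounded_closed)
  moreover have "open {y. a < \<theta> \<bullet> y - 1/2 * quad_form B \<theta>}" for \<theta> :: "real^'m"
    by (intro open_Collect_less continuous_intros)
  moreover have "K \<subseteq> (\<Union>\<theta>\<in>UNIV. {y. a < \<theta> \<bullet> y - 1/2 * quad_form B \<theta>})"
  proof
    fix y assume "y \<in> K"
    then have "ereal a < rate2 B y" using less by (auto simp: K_def)
    then show "y \<in> (\<Union>\<theta>\<in>UNIV. {y. a < \<theta> \<bullet> y - 1/2 * quad_form B \<theta>})"
      unfolding rate2_quad_form by (auto simp: less_SUP_iff)
  qed
  ultimately obtain F0 where F0: "finite F0" "K \<subseteq> (\<Union>\<theta>\<in>F0. {y. a < \<theta> \<bullet> y - 1/2 * quad_form B \<theta>})"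
    by (rule compactE_image) auto
  show ?thesis
  proof (intro exI conjI ballI)
    show "finite (A \<union> F0)" using F0 \<open>finite A\<close> by simp
    fix y assume "y \<in> C"
    show "\<exists>\<theta>\<in>A \<union> F0. a < \<theta> \<bullet> y - 1/2 * quad_form B \<theta>"
    proof (cases "y \<in> K")
      case True then show ?thesis using F0 by auto
    next
      case False then show ?thesis using \<open>y \<in> C\<close> by (auto simp: K_def not_le)
    qed
  qed
qed

text \<open>Cover \<open>C\<close> by finitely many half spaces on which the Chernoff exponent
  exceeds \<open>a\<close>, and add up. The real numbers \<open>r\<close> and \<open>a\<close> are
  inserted strictly between the two sides since either may be infinite.\<close>

lemma upper_bound:
  assumes "closed C"
  shows "limsup (\<lambda>L. ereal (1 / v L) * eln (measure (M L) {\<omega> \<in> space (M L). X L \<omega> \<in> C}))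
          \<le> - (INF y\<in>C. rate2 B y)"
    (is "?l \<le> - ?I")
proof (rule ccontr)
  assume "\<not> ?l \<le> - ?I"
  then obtain r where r: "- ?I < ereal r" "ereal r < ?l"
    using ereal_dense2[of "- ?I" ?l] by (auto simp: not_le)
  have "ereal (- r) < ?I" using r(1) by (simp add: ereal_uminus_less_reorder)
  then obtain a where a: "- r < a" "ereal a < ?I"
    using ereal_dense2[of "ereal (- r)" ?I] by auto
  have "ereal a < rate2 B y" if "y \<in> C" for y
    using a(2) that by (meson INF_lower less_le_trans)
  then obtain F where F: "finite F" "\<And>y. y \<in> C \<Longrightarrow> \<exists>\<theta>\<in>F. a < \<theta> \<bullet> y - 1/2 * quad_form B \<theta>"
    using closed_halfspace_cover[OF assms] by metis
  \<comment> \<open>Half of the gap between \<open>- r\<close> and \<open>a\<close>: one half pays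
    for the convergence of the covariances, the other for the number of half spaces.\<close>
  define e where "e = (a + r) / 2"
  have e: "e > 0" using a by (simp add: e_def)
  have "\<forall>\<^sub>F L in sequentially. \<forall>\<theta>\<in>F. v L * quad_form (V L) \<theta> < quad_form B \<theta> + 2 * e"
    using F(1) e by (intro eventually_ball_finite ballI order_tendstoD[OF quad_form_lim]) auto
  moreover have "\<forall>\<^sub>F L in sequentially. exp (v L * e) \<ge> real (card F)"
    by (rule exp_mult_eventually_ge[OF e])
  ultimately have "\<forall>\<^sub>F L in sequentially.
      ereal (1 / v L) * eln (measure (M L) {\<omega> \<in> space (M L). X L \<omega> \<in> C}) \<le> ereal r"
    using v_pos eventually_ge_at_top[of 1]
  proof eventually_elim
    case (elim L)
    interpret prob_space "M L" using elim by (intro prob)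
    note [measurable] = X_measurable[OF elim(4)]
    let ?H = "\<lambda>\<theta>. {\<omega> \<in> space (M L). \<theta> \<bullet> X L \<omega> > a + 1/2 * quad_form B \<theta>}"
    have "measure (M L) {\<omega> \<in> space (M L). X L \<omega> \<in> C} \<le> measure (M L) (\<Union>\<theta>\<in>F. ?H \<theta>)"
    proof (rule finite_measure_mono)
      show "{\<omega> \<in> space (M L). X L \<omega> \<in> C} \<subseteq> (\<Union>\<theta>\<in>F. ?H \<theta>)"
        using F(2) by (force simp: algebra_simps)
      show "(\<Union>\<theta>\<in>F. ?H \<theta>) \<in> sets (M L)"
        using F(1) by (intro sets.finite_UN) measurable
    qed
    also have "\<dots> \<le> (\<Sum>\<theta>\<in>F. measure (M L) (?H \<theta>))"
      using F(1) by (intro finite_measure_subadditive_finite) auto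
    also have "\<dots> \<le> (\<Sum>\<theta>\<in>F. exp (- v L * (a - e)))"
    proof (rule sum_mono)
      fix \<theta> assume "\<theta> \<in> F"
      have "measure (M L) (?H \<theta>) \<le> exp (1/2 * ((v L)\<^sup>2 * quad_form (V L) \<theta>) - v L * (a + 1/2 * quad_form B \<theta>))"
        using elim by (intro halfspace_bound) auto
      also have "\<dots> \<le> exp (- v L * (a - e))"
      proof -
        have "v L * (v L * quad_form (V L) \<theta>) \<le> v L * (quad_form B \<theta> + 2 * e)"
          using elim \<open>\<theta> \<in> F\<close> by (intro mult_left_mono) (auto simp: less_imp_le)
        then show ?thesis by (simp add: power2_eq_square algebra_simps)
      qed
      finally show "measure (M L) (?H \<theta>) \<le> exp (- v L * (a - e))" .
    qed
    also have "\<dots> = real (card F) * exp (- v L * (a - e))" by simp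
    also have "\<dots> \<le> exp (v L * e) * exp (- v L * (a - e))"
      using elim by (intro mult_right_mono) auto
    also have "\<dots> = exp (- v L * (- r))"
      by (simp add: mult_exp_exp e_def field_simps)
    finally show ?case using eln_upper[of "v L" _ "- r"] elim by simp
  qed
  then have "?l \<le> ereal r" by (rule Limsup_bounded)
  then show False using r(2) by simp
qed

text \<open>A box, because leaving it means that a single coordinate deviates, which a tilt along
  that axis detects. The bound on the inner product controls the density of the tilted law inside
  the box.\<close>

lemma box_in_open:
  fixes U :: "(real^'m) set" and y \<theta> :: "real^'m"
  assumes "open U" "y \<in> U" "e > 0"
  obtains \<delta> where "\<delta> > 0" "\<And>z. (\<And>i. \<bar>z $ i - y $ i\<bar> < \<delta>) \<Longrightarrow> z \<in> U \<and> \<theta> \<bullet> z \<le> \<theta> \<bullet> y + e"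
proof -
  have "open (U \<inter> {z. \<theta> \<bullet> z < \<theta> \<bullet> y + e})"
    using assms(1) by (intro open_Int open_Collect_less continuous_intros)
  moreover have "y \<in> U \<inter> {z. \<theta> \<bullet> z < \<theta> \<bullet> y + e}" using assms by simp
  ultimately obtain r where r: "r > 0" "ball y r \<subseteq> U \<inter> {z. \<theta> \<bullet> z < \<theta> \<bullet> y + e}"
    using open_contains_ball_eq by blast
  define \<delta> where "\<delta> = r / real CARD('m)"
  have "\<delta> > 0" using r by (simp add: \<delta>_def)
  moreover have "z \<in> U \<and> \<theta> \<bullet> z \<le> \<theta> \<bullet> y + e" if "\<And>i. \<bar>z $ i - y $ i\<bar> < \<delta>" for z
  proof -
    have "norm (z - y) \<le> (\<Sum>i\<in>UNIV. \<bar>(z - y) $ i\<bar>)" by (rule norm_le_l1_cart)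
    also have "\<dots> < (\<Sum>i\<in>(UNIV::'m set). \<delta>)"
      using that by (intro sum_strict_mono) auto
    also have "\<dots> = r" by (simp add: \<delta>_def)
    finally have "z \<in> ball y r" by (simp add: dist_norm norm_minus_commute)
    then show ?thesis using r by force
  qed
  ultimately show ?thesis using that by blast
qed

text \<open>Exponential tilting by \<open>v L *\<^sub>R \<theta>\<close> moves the mean to \<open>y\<close>; the tilted mass outside a
  box around \<open>y\<close> is controlled by tilting further along the axes.\<close>
lemma tilted_lower_bound:
  assumes "open U" "y \<in> U" and y: "\<And>i. y $ i = (\<Sum>j\<in>UNIV. B i j * \<theta> $ j)" and e: "e > 0"
  shows "\<forall>\<^sub>F L in sequentially.
    measure (M L) {\<omega> \<in> space (M L). X L \<omega> \<in> U} \<ge> exp (- v L * (1/2 * quad_form B \<theta> + 3 * e))"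
proof -
  let ?q = "quad_form B \<theta>"
  have ty: "\<theta> \<bullet> y = ?q" by (simp add: quad_form_eq_inner inner_vec_def y)
  obtain \<delta> where \<delta>: "\<delta> > 0" "\<And>z. (\<And>i. \<bar>z $ i - y $ i\<bar> < \<delta>) \<Longrightarrow> z \<in> U \<and> \<theta> \<bullet> z \<le> \<theta> \<bullet> y + e"
    using box_in_open[OF assms(1,2) e, of \<theta>] by metis
  define m where "m = real CARD('m)"
  have m: "m > 0" by (simp add: m_def)
  \<comment> \<open>Chosen so that each of the \<open>2 * m\<close> terms for the faces of the box
    tends to \<open>1 / (8 * m)\<close>, in total 1/4 < 1/2.\<close>
  define s where "s = ln (8 * m) / \<delta>"
  have s: "exp (- s * \<delta>) = 1 / (8 * m)" using \<delta>(1) m by (simp add: s_def exp_minus field_simps)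
  \<comment> \<open>Under the tilted law this is the Chernoff bound, with parameter
    \<open>s\<close>, for leaving the box through the face of coordinate \<open>i\<close> on side
    \<sigma>.\<close>
  define E where "E L i \<sigma> = exp (\<sigma> * s * ((\<Sum>j\<in>UNIV. v L * V L i j * \<theta> $ j) - y $ i)
      + 1/2 * (\<sigma> * s)\<^sup>2 * V L i i - s * \<delta>)" for L i and \<sigma> :: real
  have "(\<lambda>L. inverse (v L)) \<longlonglongrightarrow> 0"
    using tendsto_inverse_0_at_top[OF v_top] .
  from tendsto_mult[OF this V_lim]
  have V1: "(\<lambda>L. inverse (v L) * (v L * V L i i)) \<longlonglongrightarrow> 0" for i by simp
  \<comment> \<open>The unscaled variances vanish, so \<open>s\<close> can stay fixed while
    \<open>L\<close> grows.\<close>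
  have V0: "(\<lambda>L. V L i i) \<longlonglongrightarrow> 0" for i
  proof (rule Lim_transform_eventually[OF V1])
    show "\<forall>\<^sub>F L in sequentially. inverse (v L) * (v L * V L i i) = V L i i"
      using v_pos by eventually_elim simp
  qed
  have "(\<lambda>L. E L i \<sigma>) \<longlonglongrightarrow> exp (\<sigma> * s * ((\<Sum>j\<in>UNIV. B i j * \<theta> $ j) - y $ i)
      + 1/2 * (\<sigma> * s)\<^sup>2 * 0 - s * \<delta>)" for i \<sigma>
    unfolding E_def by (intro tendsto_intros V0 V_lim)
  then have Elim: "(\<lambda>L. E L i \<sigma>) \<longlonglongrightarrow> 1 / (8 * m)" for i \<sigma> using s by (simp add: y)
  have "(\<lambda>L. \<Sum>i\<in>UNIV. E L i 1 + E L i (-1)) \<longlonglongrightarrow> (\<Sum>i\<in>(UNIV::'m set). 1 / (8 * m) + 1 / (8 * m))"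
    by (intro tendsto_intros Elim)
  moreover have "(\<Sum>i\<in>(UNIV::'m set). 1 / (8 * m) + 1 / (8 * m)) = 1/4" using m by (simp add: m_def)
  ultimately have "(\<lambda>L. \<Sum>i\<in>UNIV. E L i 1 + E L i (-1)) \<longlonglongrightarrow> 1/4" by simp
  then have "\<forall>\<^sub>F L in sequentially. (\<Sum>i\<in>UNIV. E L i 1 + E L i (-1)) < 1/2"
    by (rule order_tendstoD) simp
  moreover have "\<forall>\<^sub>F L in sequentially. v L * quad_form (V L) \<theta> > ?q - 2 * e"
    using e by (intro order_tendstoD[OF quad_form_lim]) auto
  moreover have "\<forall>\<^sub>F L in sequentially. exp (v L * e) \<ge> 2"
    by (rule exp_mult_eventually_ge[OF e])
  ultimately show ?thesis using v_pos eventually_ge_at_top[of 1]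
  proof eventually_elim
    case (elim L)
    interpret prob_space "M L" using elim by (intro prob)
    note [measurable] = X_measurable[OF elim(5)]
    have Xi[measurable]: "(\<lambda>\<omega>. X L \<omega> $ i) \<in> borel_measurable (M L)" for i
      using measurable_compose[OF X_measurable[OF elim(5)] borel_measurable_nth[of i]] by simp
    have [measurable]: "U \<in> sets borel" using \<open>open U\<close> by simp
    let ?p = "measure (M L) {\<omega> \<in> space (M L). X L \<omega> \<in> U}"
    let ?A = "{\<omega> \<in> space (M L). X L \<omega> \<in> U}"
    have UA[measurable]: "?A \<in> sets (M L)" by measurable
    define W where "W = exp (1/2 * ((v L)\<^sup>2 * quad_form (V L) \<theta>))"
    define Z where "Z i \<sigma> \<omega> = exp ((v L *\<^sub>R \<theta> + axis i (\<sigma> * s)) \<bullet> X L \<omega>) * exp (- \<sigma> * s * y $ i - s * \<delta>)"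
      for i and \<sigma> :: real and \<omega>
    have Zint: "integrable (M L) (Z i \<sigma>)" for i \<sigma>
      unfolding Z_def by (intro integrable_mult_left exp_integrable elim)
    have ZE: "(LINT \<omega>|M L. Z i \<sigma> \<omega>) = W * E L i \<sigma>" for i \<sigma>
    proof -
      have "(LINT \<omega>|M L. Z i \<sigma> \<omega>) = exp (1/2 * quad_form (V L) (v L *\<^sub>R \<theta> + axis i (\<sigma> * s)))
          * exp (- \<sigma> * s * y $ i - s * \<delta>)"
        unfolding Z_def using elim by (subst integral_mult_left_zero) (simp add: mgf)
      also have "\<dots> = W * E L i \<sigma>"
        unfolding quad_form_add_axis[of "V L", OF V_sym] W_def E_def quad_form_scaleR
        by (simp add: mult_exp_exp algebra_simps sum_distrib_left)
      finally show ?thesis .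
    qed
    have "m \<ge> 1" unfolding m_def by (simp add: Suc_le_eq)
    then have s0: "s \<ge> 0" unfolding s_def using \<delta>(1) by simp
    \<comment> \<open>Inside the box the first term dominates; outside it, the term of the violated
      face does. Integration leaves at least half of the tilted mass to the first term.\<close>
    have pointwise: "exp ((v L *\<^sub>R \<theta>) \<bullet> X L \<omega>) \<le>
        exp (v L * (?q + e)) * indicator ?A \<omega> + (\<Sum>i\<in>UNIV. Z i 1 \<omega> + Z i (-1) \<omega>)"
      if om: "\<omega> \<in> space (M L)" for \<omega>
    proof (cases "\<forall>i. \<bar>X L \<omega> $ i - y $ i\<bar> < \<delta>")
      case True
      then have "X L \<omega> \<in> U" "\<theta> \<bullet> X L \<omega> \<le> ?q + e" using \<delta>(2)[of "X L \<omega>"] ty by auto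
      then have "exp ((v L *\<^sub>R \<theta>) \<bullet> X L \<omega>) \<le> exp (v L * (?q + e)) * indicator ?A \<omega>"
        using elim om by simp
      moreover have "0 \<le> (\<Sum>i\<in>UNIV. Z i 1 \<omega> + Z i (-1) \<omega>)"
        by (intro sum_nonneg) (simp add: Z_def)
      ultimately show ?thesis by linarith
    next
      case False
      then obtain i where i: "\<bar>X L \<omega> $ i - y $ i\<bar> \<ge> \<delta>" by (auto simp: not_less)
      have Zeq: "Z i \<sigma> \<omega> = exp ((v L *\<^sub>R \<theta>) \<bullet> X L \<omega>) * exp (s * (\<sigma> * (X L \<omega> $ i - y $ i) - \<delta>))" for \<sigma>
        unfolding Z_def by (simp add: mult_exp_exp inner_add_left inner_axis' algebra_simps)
      have "\<exists>\<sigma>\<in>{-1,1}. \<sigma> * (X L \<omega> $ i - y $ i) - \<delta> \<ge> 0"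
        using i by (cases "X L \<omega> $ i - y $ i \<ge> 0") auto
      then obtain \<sigma> where \<sigma>: "\<sigma> \<in> {-1, 1}" "\<sigma> * (X L \<omega> $ i - y $ i) - \<delta> \<ge> 0" by blast
      then have "exp ((v L *\<^sub>R \<theta>) \<bullet> X L \<omega>) * 1 \<le> Z i \<sigma> \<omega>"
        unfolding Zeq using s0 by (intro mult_left_mono) auto
      also have "\<dots> \<le> Z i 1 \<omega> + Z i (-1) \<omega>" using \<sigma>(1) by (auto simp: Z_def)
      also have "\<dots> \<le> (\<Sum>i\<in>UNIV. Z i 1 \<omega> + Z i (-1) \<omega>)"
        by (rule member_le_sum) (auto simp: Z_def)
      finally show ?thesis by (simp add: add_increasing)
    qed
    have "W = (LINT \<omega>|M L. exp ((v L *\<^sub>R \<theta>) \<bullet> X L \<omega>))"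
      using mgf[OF elim(5), of "v L *\<^sub>R \<theta>"] by (simp add: W_def quad_form_scaleR)
    also have "\<dots> \<le> (LINT \<omega>|M L. exp (v L * (?q + e)) * indicator ?A \<omega> + (\<Sum>i\<in>UNIV. Z i 1 \<omega> + Z i (-1) \<omega>))"
      using pointwise elim
      by (intro integral_mono exp_integrable Bochner_Integration.integrable_add
          Bochner_Integration.integrable_sum integrable_mult_right Zint)
         (auto simp: emeasure_finite less_top[symmetric])
    also have "\<dots> = exp (v L * (?q + e)) * ?p + (\<Sum>i\<in>UNIV. W * E L i 1 + W * E L i (-1))"
      using UA Zint by (subst Bochner_Integration.integral_add)
         (auto simp: emeasure_finite less_top[symmetric] ZE Int_absorb2 subset_eq
           intro!: Bochner_Integration.integrable_sum)
    also have "(\<Sum>i\<in>UNIV. W * E L i 1 + W * E L i (-1)) = W * (\<Sum>i\<in>UNIV. E L i 1 + E L i (-1))"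
      by (simp add: sum_distrib_left distrib_left)
    also have "\<dots> \<le> W * (1/2)" using elim by (intro mult_left_mono) (auto simp: W_def)
    finally have "W / 2 \<le> exp (v L * (?q + e)) * ?p" by simp
    moreover have "exp (v L * (1/2 * ?q - e)) \<le> W"
    proof -
      have "v L * (?q - 2 * e) \<le> v L * (v L * quad_form (V L) \<theta>)"
        using elim by (intro mult_left_mono) auto
      then show ?thesis by (simp add: W_def power2_eq_square algebra_simps)
    qed
    ultimately have "exp (v L * (1/2 * ?q - e)) / 2 \<le> exp (v L * (?q + e)) * ?p" by linarith
    \<comment> \<open>The three losses \<open>e\<close> come from the width of the box, from the
      convergence of the covariances, and from this factor 2.\<close>
    then have "exp (v L * (1/2 * ?q - e)) \<le> 2 * (exp (v L * (?q + e)) * ?p)" by simp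
    also have "\<dots> \<le> exp (v L * e) * (exp (v L * (?q + e)) * ?p)"
      using elim by (intro mult_right_mono) auto
    also have "\<dots> = exp (v L * (?q + 2 * e)) * ?p"
    proof -
      have "exp (v L * e) * exp (v L * (?q + e)) = exp (v L * (?q + 2 * e))"
        by (simp add: mult_exp_exp algebra_simps)
      then show ?thesis by simp
    qed
    finally have "exp (v L * (1/2 * ?q - e)) / exp (v L * (?q + 2 * e)) \<le> ?p"
      by (simp add: divide_le_eq mult.commute)
    moreover have "exp (v L * (1/2 * ?q - e)) / exp (v L * (?q + 2 * e)) = exp (- v L * (1/2 * ?q + 3 * e))"
      unfolding exp_diff[symmetric] by (simp add: algebra_simps)
    ultimately show ?case by simp
  qed
qed

text \<open>Only points of finite rate matter, and these are images of some \<theta> under the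
  matrix. For that \<theta> the Legendre expression at \<open>y\<close> equals half the quadratic
  form, exactly the cost of the tilt.\<close>

lemma lower_bound:
  assumes "open U"
  shows "liminf (\<lambda>L. ereal (1 / v L) * eln (measure (M L) {\<omega> \<in> space (M L). X L \<omega> \<in> U}))
          \<ge> - (INF y\<in>U. rate2 B y)"
    (is "?l \<ge> _")
proof -
  have "- ?l \<le> rate2 B y" if yU: "y \<in> U" for y
  proof (cases "rate2 B y = \<infinity>")
    case False
    then obtain \<theta> where y: "\<And>i. y $ i = (\<Sum>j\<in>UNIV. B i j * \<theta> $ j)"
      using rate2_finite_imp_range by blast
    have ty: "\<theta> \<bullet> y = quad_form B \<theta>" by (simp add: quad_form_eq_inner inner_vec_def y)
    have "ereal (- (1/2 * quad_form B \<theta>)) \<le> ?l + ereal e" if e: "e > 0" for e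
    proof -
      have e3: "e / 3 > 0" using e by simp
      have "\<forall>\<^sub>F L in sequentially. ereal (- (1/2 * quad_form B \<theta> + e)) \<le>
          ereal (1 / v L) * eln (measure (M L) {\<omega> \<in> space (M L). X L \<omega> \<in> U})"
        using tilted_lower_bound[OF assms yU y e3] v_pos
      proof eventually_elim
        case (elim L)
        then show ?case using eln_lower[of "v L" "1/2 * quad_form B \<theta> + e"] by simp
      qed
      then have "ereal (- (1/2 * quad_form B \<theta> + e)) \<le> ?l" by (rule Liminf_bounded)
      then have "ereal (- (1/2 * quad_form B \<theta> + e)) + ereal e \<le> ?l + ereal e"
        by (rule add_right_mono)
      then show ?thesis by simp
    qed
    then have "ereal (- (1/2 * quad_form B \<theta>)) \<le> ?l"
      by (rule ereal_le_epsilon2)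
    then have "- ?l \<le> ereal (1/2 * quad_form B \<theta>)"
      by (simp add: ereal_uminus_le_reorder)
    also have "\<dots> \<le> rate2 B y" using rate2_ge[of \<theta> y B] by (simp add: ty)
    finally show ?thesis .
  qed simp
  then have "- ?l \<le> (INF y\<in>U. rate2 B y)" by (rule INF_greatest)
  then show ?thesis by (simp add: ereal_uminus_le_reorder)
qed

theorem LDP_rate2: "LDP M X v (rate2 B)"
  unfolding LDP_def using v_top rate2_nonneg closed_sublevel_rate2 upper_bound lower_bound by blast

end

section \<open>The Gaussian law of the centered field\<close>

lemma std_normal_mgf:
  "integrable lborel (\<lambda>x. std_normal_density x * exp (s * x))"
  "(LINT x|lborel. std_normal_density x * exp (s * x)) = exp (s\<^sup>2 / 2)"
proof -
  have eq: "std_normal_density x * exp (s * x) = exp (s\<^sup>2 / 2) * normal_density s 1 x" for x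
  proof -
    have "exp (- x\<^sup>2 / 2) * exp (s * x) = exp (s\<^sup>2 / 2) * exp (- (x - s)\<^sup>2 / 2)"
      unfolding mult_exp_exp by (simp add: power2_eq_square field_simps)
    then show ?thesis by (simp add: normal_density_def field_simps)
  qed
  show "integrable lborel (\<lambda>x. std_normal_density x * exp (s * x))"
    unfolding eq by (intro integrable_mult_right integrable_normal_density) simp
  show "(LINT x|lborel. std_normal_density x * exp (s * x)) = exp (s\<^sup>2 / 2)"
    unfolding eq by (simp add: integral_normal_density)
qed

lemma char_distr_cis:
  assumes "Y \<in> borel_measurable M"
  shows "char (distr M borel Y) s = (LINT \<omega>|M. cis (s * Y \<omega>))"
  unfolding char_def using assms
  by (subst integral_distr) (auto simp: cis_conv_exp)

text \<open>The characteristic function speaks about imaginary exponentials only. Levy's uniqueness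
  theorem identifies the law, and real exponential moments are computed for that law. The degenerate
  case is separate because standardising divides by the deviation.\<close>

lemma gaussian_char_imp_mgf:
  assumes "prob_space M" and Y[measurable]: "Y \<in> borel_measurable M"
    and char: "\<And>s. (LINT \<omega>|M. cis (s * Y \<omega>)) = complex_of_real (exp (- (1/2) * s\<^sup>2 * V))"
  shows "integrable M (\<lambda>\<omega>. exp (Y \<omega>)) \<and> (LINT \<omega>|M. exp (Y \<omega>)) = exp (1/2 * V)"
proof -
  interpret prob_space M by fact
  have rd: "real_distribution (distr M borel Z)" if "Z \<in> borel_measurable M" for Z :: "'a \<Rightarrow> real"
    using that by (simp add: real_distribution_def real_distribution_axioms_def prob_space_distr)
  \<comment> \<open>A characteristic function has modulus at most 1; at \<open>s = 1\<close> this
    forces \<open>V\<close> to be nonnegative.\<close>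
  have "norm (LINT \<omega>|M. cis (1 * Y \<omega>)) \<le> (LINT \<omega>|M. norm (cis (1 * Y \<omega>)))"
    by (rule integral_norm_bound)
  then have "exp (- (1/2) * V) \<le> 1"
    unfolding char by (simp add: prob_space)
  then have V: "V \<ge> 0" by simp
  show ?thesis
  proof (cases "V = 0")
    case True
    have rr: "real_distribution (return borel (0::real))"
      by (simp add: real_distribution_def real_distribution_axioms_def prob_space_return)
    have "char (distr M borel Y) = char (return borel 0)"
    proof
      fix s show "char (distr M borel Y) s = char (return borel 0) s"
        unfolding char_distr_cis[OF Y] char[of s] True by (simp add: char_def integral_return)
    qed
    then have D: "distr M borel Y = return borel 0"
      using Levy_uniqueness[OF rd[OF Y] rr] by simp
    have "integrable (distr M borel Y) exp"
      unfolding D by (simp add: integrable_iff_bounded nn_integral_return)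
    moreover have "(LINT x|distr M borel Y. exp x) = 1"
      unfolding D by (simp add: integral_return)
    ultimately show ?thesis
      by (simp add: integrable_distr_eq integral_distr True)
  next
    case False
    define \<sigma> where "\<sigma> = sqrt V"
    have \<sigma>: "\<sigma> > 0" "\<sigma>\<^sup>2 = V" using V False by (auto simp: \<sigma>_def)
    define Z where "Z \<omega> = Y \<omega> / \<sigma>" for \<omega>
    have Z[measurable]: "Z \<in> borel_measurable M" unfolding Z_def by measurable
    have "char (distr M borel Z) = char std_normal_distribution"
    proof
      fix s
      have "char (distr M borel Z) s = (LINT \<omega>|M. cis ((s / \<sigma>) * Y \<omega>))"
        unfolding char_distr_cis[OF Z] by (simp add: Z_def)
      also have "\<dots> = complex_of_real (exp (- (s\<^sup>2) / 2))"
        unfolding char using \<sigma> False by (simp add: power_divide)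
      finally show "char (distr M borel Z) s = char std_normal_distribution s"
        by (simp add: char_std_normal_distribution)
    qed
    then have D: "distr M borel Z = std_normal_distribution"
      using Levy_uniqueness[OF rd[OF Z] real_dist_normal_dist] by simp
    have "integrable std_normal_distribution (\<lambda>x. exp (\<sigma> * x))"
      using std_normal_mgf(1)[of \<sigma>] by (subst integrable_density) auto
    moreover have "(LINT x|std_normal_distribution. exp (\<sigma> * x)) = exp (V / 2)"
      using std_normal_mgf(2)[of \<sigma>] \<sigma>(2) by (subst integral_density) auto
    ultimately have "integrable M (\<lambda>\<omega>. exp (\<sigma> * Z \<omega>))" "(LINT \<omega>|M. exp (\<sigma> * Z \<omega>)) = exp (V / 2)"
      unfolding D[symmetric] by (simp_all add: integrable_distr_eq integral_distr)
    then show ?thesis using \<sigma>(1) by (simp add: Z_def)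
  qed
qed

text \<open>Pointwise approximation of the identity of the sphere by simple functions with values in the
  sphere turns spherical averages into limits of finite linear combinations.\<close>
lemma sphere_simple_approx:
  obtains s :: "nat \<Rightarrow> 'a::euclidean_space \<Rightarrow> 'a"
  where "\<And>n. simple_function sphere_prob (s n)" "\<And>n y. s n y \<in> sphere 0 1"
    "\<And>y. y \<in> sphere 0 1 \<Longrightarrow> (\<lambda>n. s n y) \<longlonglongrightarrow> y"
proof -
  obtain e :: 'a where e: "e \<in> Basis" using nonempty_Basis by blast
  have "(\<lambda>y::'a. y) \<in> borel_measurable sphere_prob"
    by (intro continuous_on_sphere_measurable continuous_intros)
  from borel_measurable_implies_sequence_metric[OF this, of 0]
  obtain F :: "nat \<Rightarrow> 'a \<Rightarrow> 'a" where F: "\<And>n. simple_function sphere_prob (F n)"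
      "\<And>y. y \<in> space sphere_prob \<Longrightarrow> (\<lambda>n. F n y) \<longlonglongrightarrow> y"
    by metis
  \<comment> \<open>Radial projection to the sphere; the value \<open>e\<close> at the origin keeps
    every approximant on the sphere.\<close>
  define nz where "nz z = (if z = 0 then e else z /\<^sub>R norm z)" for z :: 'a
  show ?thesis
  proof (rule that[of "\<lambda>n y. nz (F n y)"])
    show "simple_function sphere_prob (\<lambda>y. nz (F n y))" for n
      using F(1) by (rule simple_function_compose1)
    show "nz (F n y) \<in> sphere 0 1" for n y
      using e by (simp add: nz_def)
    fix y :: 'a assume y: "y \<in> sphere 0 1"
    then have lim: "(\<lambda>n. F n y) \<longlonglongrightarrow> y" and y0: "y \<noteq> 0" "norm y = 1"
      using F(2) by (auto simp: space_sphere_prob)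
    have "(\<lambda>n. F n y /\<^sub>R norm (F n y)) \<longlonglongrightarrow> y /\<^sub>R norm y"
      using y0 by (intro tendsto_intros lim) auto
    moreover have "\<forall>\<^sub>F n in sequentially. F n y /\<^sub>R norm (F n y) = nz (F n y)"
      using tendsto_imp_eventually_ne[OF lim y0(1)] by eventually_elim (simp add: nz_def)
    ultimately show "(\<lambda>n. nz (F n y)) \<longlonglongrightarrow> y"
      using Lim_transform_eventually[of "\<lambda>n. F n y /\<^sub>R norm (F n y)"] y0 by simp
  qed
qed

lemma integral_simple_comp:
  fixes s :: "'a \<Rightarrow> 'b" and f :: "'b \<Rightarrow> real"
  assumes "prob_space N" and s: "simple_function N s"
  shows "(LINT y|N. f (s y)) = (\<Sum>p\<in>s ` space N. measure N (s -` {p} \<inter> space N) * f p)"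
proof -
  interpret prob_space N by fact
  have fin: "finite (s ` space N)" using s by (rule simple_functionD)
  have m: "s -` {p} \<inter> space N \<in> sets N" for p using s by (rule simple_functionD)
  have "(LINT y|N. f (s y)) = (LINT y|N. (\<Sum>p\<in>s ` space N. indicator (s -` {p} \<inter> space N) y * f p))"
  proof (rule Bochner_Integration.integral_cong[OF refl])
    fix y assume y: "y \<in> space N"
    have "(\<Sum>p\<in>s ` space N. indicator (s -` {p} \<inter> space N) y * f p) =
        (\<Sum>p\<in>s ` space N. if p = s y then f p else 0)"
      using y by (intro sum.cong) (auto simp: indicator_def)
    then show "f (s y) = (\<Sum>p\<in>s ` space N. indicator (s -` {p} \<inter> space N) y * f p)"
      using fin y by simp
  qed
  also have "\<dots> = (\<Sum>p\<in>s ` space N. measure N (s -` {p} \<inter> space N) * f p)"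
    using m by (subst Bochner_Integration.integral_sum)
      (auto simp: emeasure_finite less_top[symmetric] Int_absorb2)
  finally show ?thesis .
qed

text \<open>Reindexing to an arbitrary finite index set, later a disjoint sum of observation points
  and approximation points. Repeated points are allowed.\<close>

lemma gaussian_field_finite_sum:
  assumes g: "centered_gaussian_field M S T K" and I: "finite I" and p: "\<And>i. i \<in> I \<Longrightarrow> p i \<in> S"
  shows "(LINT \<omega>|M. cis (\<Sum>i\<in>I. a i * T \<omega> (p i))) =
    complex_of_real (exp (- (1/2) * (\<Sum>i\<in>I. \<Sum>j\<in>I. a i * a j * K (p i) (p j))))"
proof -
  obtain f where f: "bij_betw f {..<card I} I"
    using ex_bij_betw_nat_finite[OF I] by (auto simp: atLeast0LessThan)
  have re: "sum h I = (\<Sum>k<card I. h (f k))" for h :: "_ \<Rightarrow> real"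
    using sum.reindex_bij_betw[OF f, of h] by simp
  have range: "\<forall>k<card I. p (f k) \<in> S" using f p by (auto simp: bij_betw_def)
  have "\<forall>(n::nat) p a. (\<forall>k<n. p k \<in> S) \<longrightarrow> (LINT \<omega>|M. cis (\<Sum>k<n. a k * T \<omega> (p k)))
      = complex_of_real (exp (- (1/2) * (\<Sum>j<n. \<Sum>k<n. a j * a k * K (p j) (p k))))"
    using g unfolding centered_gaussian_field_def by blast
  from this[rule_format, of "card I" "\<lambda>k. p (f k)" "\<lambda>k. a (f k)"] show ?thesis
    unfolding re using range by blast
qed

lemma gaussian_field_measurable:
  "centered_gaussian_field M S T K \<Longrightarrow> x \<in> S \<Longrightarrow> (\<lambda>\<omega>. T \<omega> x) \<in> borel_measurable M"
  by (simp add: centered_gaussian_field_def)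

section \<open>Spherical averages as limits of finite combinations\<close>

lemma tendsto_integral_simple_approx:
  fixes f :: "'a::euclidean_space \<Rightarrow> real"
  assumes s: "\<And>n. simple_function sphere_prob (s n)" "\<And>n y. s n y \<in> sphere 0 1"
    "\<And>y. y \<in> sphere 0 1 \<Longrightarrow> (\<lambda>n. s n y) \<longlonglongrightarrow> y"
    and f: "continuous_on (sphere 0 1) f"
  shows "(\<lambda>n. LINT y|sphere_prob. f (s n y)) \<longlonglongrightarrow> (LINT y|sphere_prob. f y)"
proof -
  interpret prob_space "sphere_prob :: 'a measure" by (rule prob_space_sphere_prob)
  have "bounded (f ` sphere 0 1)"
    using f by (intro compact_imp_bounded compact_continuous_image) auto
  then obtain C where C: "\<And>y. y \<in> sphere 0 1 \<Longrightarrow> norm (f y) \<le> C"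
    unfolding bounded_iff by blast
  show ?thesis
  proof (rule integral_dominated_convergence[where w = "\<lambda>_. C"])
    show "f \<in> borel_measurable sphere_prob" by (rule continuous_on_sphere_measurable[OF f])
    show "(\<lambda>y. f (s n y)) \<in> borel_measurable sphere_prob" for n
      using simple_function_compose1[OF s(1)] by (rule borel_measurable_simple_function)
    show "AE y in sphere_prob. (\<lambda>n. f (s n y)) \<longlonglongrightarrow> f y"
      using s by (intro AE_I2 continuous_on_tendsto_compose[OF f]) (auto simp: space_sphere_prob simp del: mem_sphere_0)
    show "AE y in sphere_prob. norm (f (s n y)) \<le> C" for n
      using C s by (intro AE_I2) blast
  qed simp
qed

text \<open>\<open>A\<close> is the mean of the covariance with a fixed point, the same for every
  point. It is therefore both the covariance of the field with its average and the variance of the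
  average.\<close>

context
  fixes M :: "'w measure" and T :: "'w \<Rightarrow> 'a::euclidean_space \<Rightarrow> real" and k :: "real \<Rightarrow> real"
    and xs :: "'m::finite \<Rightarrow> 'a" and A :: real
  assumes M: "prob_space M"
    and cont: "\<And>\<omega>. \<omega> \<in> space M \<Longrightarrow> continuous_on (sphere 0 1) (T \<omega>)"
    and gauss: "centered_gaussian_field M (sphere 0 1) T (\<lambda>x y. k (x \<bullet> y))"
    and k_cont: "continuous_on {-1..1} k"
    and k_mean: "\<And>x :: 'a. x \<in> sphere 0 1 \<Longrightarrow> (LINT y|sphere_prob. k (x \<bullet> y)) = A"
    and xs: "\<And>i. xs i \<in> sphere 0 1"
begin

lemma inner_sphere_mem: "x \<in> sphere 0 1 \<Longrightarrow> y \<in> sphere 0 1 \<Longrightarrow> x \<bullet> y \<in> {-1..1}"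
  for x y :: 'a
  using Cauchy_Schwarz_ineq2[of x y] by (auto simp: abs_le_iff)

lemma k_inner_cont: "x \<in> sphere 0 1 \<Longrightarrow> continuous_on (sphere 0 1) (\<lambda>y. k (x \<bullet> y))"
  for x :: 'a
  using inner_sphere_mem by (intro continuous_on_compose2[OF k_cont] continuous_intros) blast

lemma sphere_avg_tendsto:
  assumes s: "\<And>n. simple_function sphere_prob (s n)" "\<And>n y. s n y \<in> sphere 0 1"
    "\<And>y. y \<in> sphere 0 1 \<Longrightarrow> (\<lambda>n. s n y) \<longlonglongrightarrow> y"
    and \<omega>: "\<omega> \<in> space M"
  shows "(\<lambda>n. LINT y|sphere_prob. T \<omega> (s n y)) \<longlonglongrightarrow> sphere_avg (T \<omega>)"
  using tendsto_integral_simple_approx[OF s cont[OF \<omega>]]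
  by (simp add: sphere_avg_eq_integral continuous_on_sphere_measurable cont[OF \<omega>])

lemma simple_avg_measurable:
  assumes s: "\<And>n. simple_function sphere_prob (s n)" "\<And>n y. s n y \<in> sphere 0 1"
  shows "(\<lambda>\<omega>. LINT y|sphere_prob. T \<omega> (s n y)) \<in> borel_measurable M"
proof -
  have "(\<lambda>\<omega>. \<Sum>p\<in>s n ` space sphere_prob. measure sphere_prob (s n -` {p} \<inter> space sphere_prob) * T \<omega> p)
      \<in> borel_measurable M"
    using s(2) by (intro borel_measurable_sum borel_measurable_times borel_measurable_const
        gaussian_field_measurable[OF gauss]) auto
  then show ?thesis by (simp add: integral_simple_comp[OF prob_space_sphere_prob s(1)])
qed

text \<open>Measurability in \<omega> of an integral over the sphere: by continuity of the paths,
  the average is a pointwise limit of finite weighted sums of field values.\<close>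

lemma sphere_avg_measurable: "(\<lambda>\<omega>. sphere_avg (T \<omega>)) \<in> borel_measurable M"
proof -
  obtain s :: "nat \<Rightarrow> 'a \<Rightarrow> 'a" where s: "\<And>n. simple_function sphere_prob (s n)" "\<And>n y. s n y \<in> sphere 0 1"
    "\<And>y. y \<in> sphere 0 1 \<Longrightarrow> (\<lambda>n. s n y) \<longlonglongrightarrow> y"
    using sphere_simple_approx by metis
  show ?thesis
    using sphere_avg_tendsto[OF s] simple_avg_measurable[OF s(1,2)]
    by (rule borel_measurable_LIMSEQ_real)
qed

text \<open>Both variables are approximated by the same \<open>s n\<close>, so dominated convergence
  is applied twice; the inner limit \<open>A\<close> does not depend on the outer point.\<close>

lemma tendsto_double_integral_simple_approx:
  assumes s: "\<And>n. simple_function sphere_prob (s n)" "\<And>n y. s n y \<in> sphere 0 1"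
    "\<And>y. y \<in> sphere 0 1 \<Longrightarrow> (\<lambda>n. s n y) \<longlonglongrightarrow> (y :: 'a)"
  shows "(\<lambda>n. LINT y|sphere_prob. LINT z|sphere_prob. k (s n y \<bullet> s n z)) \<longlonglongrightarrow> A"
proof -
  interpret prob_space "sphere_prob :: 'a measure" by (rule prob_space_sphere_prob)
  have "bounded (k ` {-1..1})"
    using k_cont by (intro compact_imp_bounded compact_continuous_image) auto
  then obtain C where C: "\<And>t. t \<in> {-1..1} \<Longrightarrow> norm (k t) \<le> C"
    unfolding bounded_iff by blast
  have meas: "(\<lambda>z. k (x \<bullet> s n z)) \<in> borel_measurable sphere_prob" for x n
    using simple_function_compose1[OF s(1)] by (rule borel_measurable_simple_function)
  have "(\<lambda>n. LINT z|sphere_prob. k (s n y \<bullet> s n z)) \<longlonglongrightarrow> A" if y: "y \<in> sphere 0 1" for y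
    unfolding k_mean[OF y, symmetric]
  proof (rule integral_dominated_convergence[where w = "\<lambda>_. C"])
    show "(\<lambda>z. k (y \<bullet> z)) \<in> borel_measurable sphere_prob"
      by (rule continuous_on_sphere_measurable[OF k_inner_cont[OF y]])
    show "AE z in sphere_prob. (\<lambda>n. k (s n y \<bullet> s n z)) \<longlonglongrightarrow> k (y \<bullet> z)"
    proof (rule AE_I2)
      fix z :: 'a assume "z \<in> space sphere_prob"
      then have z: "z \<in> sphere 0 1" by (simp add: space_sphere_prob)
      show "(\<lambda>n. k (s n y \<bullet> s n z)) \<longlonglongrightarrow> k (y \<bullet> z)"
        by (rule continuous_on_tendsto_compose[OF k_cont tendsto_inner[OF s(3)[OF y] s(3)[OF z]]])
           (intro inner_sphere_mem y z always_eventually allI s(2))+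
    qed
    show "AE z in sphere_prob. norm (k (s n y \<bullet> s n z)) \<le> C" for n
      by (intro AE_I2 C inner_sphere_mem s(2))
  qed (use meas in auto)
  note inner = this
  have "(\<lambda>n. LINT y|sphere_prob. LINT z|sphere_prob. k (s n y \<bullet> s n z)) \<longlonglongrightarrow> (LINT y|(sphere_prob :: 'a measure). A)"
  proof (rule integral_dominated_convergence[where w = "\<lambda>_. C"])
    show "(\<lambda>y. LINT z|sphere_prob. k (s n y \<bullet> s n z)) \<in> borel_measurable sphere_prob" for n
      using simple_function_compose1[OF s(1)[of n], of "\<lambda>x. LINT z|sphere_prob. k (x \<bullet> s n z)"]
      by (rule borel_measurable_simple_function)
    show "AE y in sphere_prob. (\<lambda>n. LINT z|sphere_prob. k (s n y \<bullet> s n z)) \<longlonglongrightarrow> A"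
      using inner by (intro AE_I2) (simp add: space_sphere_prob)
    show "AE y in sphere_prob. norm (LINT z|sphere_prob. k (s n y \<bullet> s n z)) \<le> C" for n
    proof (rule AE_I2)
      fix y
      have le: "norm (k (s n y \<bullet> s n z)) \<le> C" for z
        by (intro C inner_sphere_mem s(2))
      then have "integrable sphere_prob (\<lambda>z. k (s n y \<bullet> s n z))"
        using meas by (intro integrable_const_bound[of _ C]) auto
      then have "(LINT z|sphere_prob. norm (k (s n y \<bullet> s n z))) \<le> (LINT z|(sphere_prob :: 'a measure). C)"
        using le by (intro integral_mono integrable_norm) auto
      with integral_norm_bound[of sphere_prob "\<lambda>z. k (s n y \<bullet> s n z)"]
      have "norm (LINT z|sphere_prob. k (s n y \<bullet> s n z)) \<le> (LINT z|(sphere_prob :: 'a measure). C)"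
        by linarith
      then show "norm (LINT z|sphere_prob. k (s n y \<bullet> s n z)) \<le> C" by (simp add: prob_space)
    qed
  qed auto
  then show ?thesis by (simp add: prob_space)
qed

lemma centered_char:
  fixes \<theta> :: "real^'m"
  shows "(LINT \<omega>|M. cis (\<theta> \<bullet> (\<chi> i. T \<omega> (xs i) - sphere_avg (T \<omega>)))) =
    complex_of_real (exp (- (1/2) * quad_form (\<lambda>i j. k (xs i \<bullet> xs j) - A) \<theta>))"
proof -
  interpret prob_space M by (rule M)
  obtain s :: "nat \<Rightarrow> 'a \<Rightarrow> 'a" where s: "\<And>n. simple_function sphere_prob (s n)" "\<And>n y. s n y \<in> sphere 0 1"
    "\<And>y. y \<in> sphere 0 1 \<Longrightarrow> (\<lambda>n. s n y) \<longlonglongrightarrow> y"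
    using sphere_simple_approx by metis
  define \<Theta> where "\<Theta> = (\<Sum>i\<in>UNIV. \<theta> $ i)"
  define Q where "Q = (\<Sum>i\<in>UNIV. \<Sum>j\<in>UNIV. \<theta> $ i * \<theta> $ j * k (xs i \<bullet> xs j))"
  define a where "a n x = (LINT y|sphere_prob. k (x \<bullet> s n y))" for n x
  define b where "b n = (LINT y|sphere_prob. a n (s n y))" for n
  define Y where "Y n \<omega> = (\<Sum>i\<in>UNIV. \<theta> $ i * T \<omega> (xs i)) - \<Theta> * (LINT y|sphere_prob. T \<omega> (s n y))" for n \<omega>
  note simple_sum = integral_simple_comp[OF prob_space_sphere_prob s(1)]
  have Ychar: "(LINT \<omega>|M. cis (Y n \<omega>)) =
      complex_of_real (exp (- (1/2) * (Q - 2 * \<Theta> * (\<Sum>i\<in>UNIV. \<theta> $ i * a n (xs i)) + \<Theta>\<^sup>2 * b n)))" for n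
  proof -
    let ?P = "s n ` space sphere_prob"
    define w where "w p = measure sphere_prob (s n -` {p} \<inter> space sphere_prob)" for p
    have P: "finite ?P" using s(1) by (rule simple_functionD)
    \<comment> \<open>\<open>Inl\<close> marks observation points, \<open>Inr\<close> values of
      \<open>s n\<close>. The tags keep both apart even if a value coincides with an observation
      point.\<close>
    define p where "p = case_sum xs (\<lambda>p. p)"
    define c where "c = case_sum (\<lambda>i. \<theta> $ i) (\<lambda>p. - \<Theta> * w p)"
    have pS: "p i \<in> sphere 0 1" if "i \<in> UNIV <+> ?P" for i
      using that xs s(2) by (auto simp: p_def simp del: mem_sphere_0)
    have sum_Plus: "sum g (UNIV <+> ?P) = (\<Sum>i\<in>UNIV. g (Inl i)) + (\<Sum>q\<in>?P. g (Inr q))"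
      for g :: "'m + 'a \<Rightarrow> real"
      using P by (subst sum.Plus) (auto simp: comp_def)
    have aw: "a n x = (\<Sum>q\<in>?P. w q * k (x \<bullet> q))" for x
      unfolding a_def w_def by (rule simple_sum)
    have bw: "b n = (\<Sum>q\<in>?P. w q * a n q)"
      unfolding b_def w_def by (rule simple_sum)
    have "Y n \<omega> = (\<Sum>i\<in>UNIV <+> ?P. c i * T \<omega> (p i))" for \<omega>
      unfolding Y_def sum_Plus by (simp add: c_def p_def simple_sum w_def sum_distrib_left sum_negf mult.assoc)
    then have "(LINT \<omega>|M. cis (Y n \<omega>)) = complex_of_real (exp (- (1/2) *
        (\<Sum>i\<in>UNIV <+> ?P. \<Sum>j\<in>UNIV <+> ?P. c i * c j * k (p i \<bullet> p j))))"
      using gaussian_field_finite_sum[OF gauss _ pS, where a = c] P by simp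
    also have "(\<Sum>i\<in>UNIV <+> ?P. \<Sum>j\<in>UNIV <+> ?P. c i * c j * k (p i \<bullet> p j)) =
        Q - 2 * \<Theta> * (\<Sum>i\<in>UNIV. \<theta> $ i * a n (xs i)) + \<Theta>\<^sup>2 * b n"
    proof -
      have r1: "(\<Sum>j\<in>UNIV <+> ?P. c (Inl i) * c j * k (p (Inl i) \<bullet> p j)) =
          (\<Sum>j\<in>UNIV. \<theta> $ i * \<theta> $ j * k (xs i \<bullet> xs j)) - \<Theta> * (\<theta> $ i * a n (xs i))" for i
        unfolding sum_Plus aw
        by (simp add: c_def p_def sum_distrib_left sum_negf mult_ac)
      have r2: "(\<Sum>j\<in>UNIV <+> ?P. c (Inr q) * c j * k (p (Inr q) \<bullet> p j)) =
          - \<Theta> * (\<Sum>j\<in>UNIV. \<theta> $ j * (w q * k (xs j \<bullet> q))) + \<Theta>\<^sup>2 * (w q * a n q)" for q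
        unfolding sum_Plus aw
        by (simp add: c_def p_def sum_distrib_left sum_negf power2_eq_square mult_ac inner_commute)
      have r3: "(\<Sum>q\<in>?P. \<Sum>j\<in>UNIV. \<theta> $ j * (w q * k (xs j \<bullet> q))) = (\<Sum>i\<in>UNIV. \<theta> $ i * a n (xs i))"
        unfolding aw sum_distrib_left by (rule sum.swap)
      have "(\<Sum>i\<in>UNIV <+> ?P. \<Sum>j\<in>UNIV <+> ?P. c i * c j * k (p i \<bullet> p j)) =
          (\<Sum>i\<in>UNIV. (\<Sum>j\<in>UNIV. \<theta> $ i * \<theta> $ j * k (xs i \<bullet> xs j)) - \<Theta> * (\<theta> $ i * a n (xs i))) +
          (\<Sum>q\<in>?P. - \<Theta> * (\<Sum>j\<in>UNIV. \<theta> $ j * (w q * k (xs j \<bullet> q))) + \<Theta>\<^sup>2 * (w q * a n q))"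
        by (simp only: sum_Plus[of "\<lambda>i. \<Sum>j\<in>UNIV <+> ?P. c i * c j * k (p i \<bullet> p j)"] r1 r2)
      also have "\<dots> = (Q - \<Theta> * (\<Sum>i\<in>UNIV. \<theta> $ i * a n (xs i))) +
          (- \<Theta> * (\<Sum>i\<in>UNIV. \<theta> $ i * a n (xs i)) + \<Theta>\<^sup>2 * b n)"
        by (simp only: sum_subtractf sum.distrib sum_distrib_left[symmetric, where r = "\<Theta>"]
            sum_distrib_left[symmetric, where r = "- \<Theta>"] sum_distrib_left[symmetric, where r = "\<Theta>\<^sup>2"]
            Q_def bw r3)
      finally show ?thesis by (simp add: algebra_simps)
    qed
    finally show ?thesis .
  qed
  have alim: "(\<lambda>n. a n (xs i)) \<longlonglongrightarrow> A" for i
    using tendsto_integral_simple_approx[OF s k_inner_cont[OF xs[of i]]]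
    by (simp add: a_def k_mean[OF xs])
  have blim: "b \<longlonglongrightarrow> A"
    unfolding b_def a_def by (rule tendsto_double_integral_simple_approx[OF s])
  have "(\<lambda>n. complex_of_real (exp (- (1/2) * (Q - 2 * \<Theta> * (\<Sum>i\<in>UNIV. \<theta> $ i * a n (xs i)) + \<Theta>\<^sup>2 * b n)))) \<longlonglongrightarrow>
      complex_of_real (exp (- (1/2) * (Q - 2 * \<Theta> * (\<Sum>i\<in>UNIV. \<theta> $ i * A) + \<Theta>\<^sup>2 * A)))"
    by (intro tendsto_intros alim blim)
  then have lim1: "(\<lambda>n. LINT \<omega>|M. cis (Y n \<omega>)) \<longlonglongrightarrow>
      complex_of_real (exp (- (1/2) * (Q - 2 * \<Theta> * (\<Sum>i\<in>UNIV. \<theta> $ i * A) + \<Theta>\<^sup>2 * A)))"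
    unfolding Ychar .
  define Z where "Z \<omega> = (\<Sum>i\<in>UNIV. \<theta> $ i * T \<omega> (xs i)) - \<Theta> * sphere_avg (T \<omega>)" for \<omega>
  have [measurable]: "(\<lambda>\<omega>. T \<omega> (xs i)) \<in> borel_measurable M" for i
    by (rule gaussian_field_measurable[OF gauss xs])
  note [measurable] = sphere_avg_measurable simple_avg_measurable[OF s(1,2)]
  have cis_m: "cis \<in> borel_measurable borel"
    by (intro borel_measurable_continuous_onI continuous_intros)
  have lim2: "(\<lambda>n. LINT \<omega>|M. cis (Y n \<omega>)) \<longlonglongrightarrow> (LINT \<omega>|M. cis (Z \<omega>))"
  proof (rule integral_dominated_convergence[where w = "\<lambda>_. 1"])
    show "(\<lambda>\<omega>. cis (Z \<omega>)) \<in> borel_measurable M"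
      unfolding Z_def by (intro measurable_compose[OF _ cis_m]) measurable
    show "(\<lambda>\<omega>. cis (Y n \<omega>)) \<in> borel_measurable M" for n
      unfolding Y_def by (intro measurable_compose[OF _ cis_m]) measurable
    show "AE \<omega> in M. (\<lambda>n. cis (Y n \<omega>)) \<longlonglongrightarrow> cis (Z \<omega>)"
      unfolding Y_def Z_def
      by (intro AE_I2 tendsto_intros sphere_avg_tendsto[OF s] isCont_tendsto_compose[of _ cis] continuous_intros)
  qed auto
  have "(LINT \<omega>|M. cis (Z \<omega>)) = complex_of_real (exp (- (1/2) * (Q - 2 * \<Theta> * (\<Sum>i\<in>UNIV. \<theta> $ i * A) + \<Theta>\<^sup>2 * A)))"
    by (rule LIMSEQ_unique[OF lim2 lim1])
  \<comment> \<open>The cross terms contribute twice \<Theta>^2 A with a minus sign and the variance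
    of the average once with a plus sign, so every covariance is lowered by
    \<open>A\<close>.\<close>
  moreover have "Q - 2 * \<Theta> * (\<Sum>i\<in>UNIV. \<theta> $ i * A) + \<Theta>\<^sup>2 * A = quad_form (\<lambda>i j. k (xs i \<bullet> xs j) - A) \<theta>"
  proof -
    have "(\<Sum>i\<in>UNIV. \<Sum>j\<in>UNIV. \<theta> $ i * A * \<theta> $ j) = \<Theta>\<^sup>2 * A"
      unfolding \<Theta>_def power2_eq_square sum_product by (simp add: sum_distrib_left mult_ac)
    moreover have "(\<Sum>i\<in>UNIV. \<theta> $ i * A) = \<Theta> * A" by (simp add: \<Theta>_def sum_distrib_right)
    moreover have "quad_form (\<lambda>i j. k (xs i \<bullet> xs j) - A) \<theta> = Q - (\<Sum>i\<in>UNIV. \<Sum>j\<in>UNIV. \<theta> $ i * A * \<theta> $ j)"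
      by (simp add: quad_form_def Q_def sum_subtractf[symmetric] algebra_simps)
    ultimately show ?thesis by (simp add: power2_eq_square algebra_simps)
  qed
  moreover have "Z \<omega> = \<theta> \<bullet> (\<chi> i. T \<omega> (xs i) - sphere_avg (T \<omega>))" for \<omega>
    unfolding Z_def inner_vec_def \<Theta>_def sum_distrib_right
    by (simp add: sum_subtractf right_diff_distrib)
  ultimately show ?thesis by simp
qed

lemma centered_measurable: "(\<lambda>\<omega>. \<chi> i. T \<omega> (xs i) - sphere_avg (T \<omega>)) \<in> borel_measurable M"
proof -
  have "(\<lambda>\<omega>. T \<omega> (xs i) - sphere_avg (T \<omega>)) \<in> borel_measurable M" for i
    by (intro borel_measurable_diff gaussian_field_measurable[OF gauss xs] sphere_avg_measurable)
  then show ?thesis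
    by (subst borel_measurable_euclidean_space) (auto simp: Basis_vec_def inner_axis)
qed

lemma centered_mgf:
  fixes \<theta> :: "real^'m"
  defines "X \<equiv> \<lambda>\<omega>. \<chi> i. T \<omega> (xs i) - sphere_avg (T \<omega>)"
  shows "integrable M (\<lambda>\<omega>. exp (\<theta> \<bullet> X \<omega>)) \<and>
    (LINT \<omega>|M. exp (\<theta> \<bullet> X \<omega>)) = exp (1/2 * quad_form (\<lambda>i j. k (xs i \<bullet> xs j) - A) \<theta>)"
proof (rule gaussian_char_imp_mgf[OF M])
  have [measurable]: "X \<in> borel_measurable M" unfolding X_def by (rule centered_measurable)
  show "(\<lambda>\<omega>. \<theta> \<bullet> X \<omega>) \<in> borel_measurable M" by measurable
  show "(LINT \<omega>|M. cis (s * (\<theta> \<bullet> X \<omega>))) =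
      complex_of_real (exp (- (1/2) * s\<^sup>2 * quad_form (\<lambda>i j. k (xs i \<bullet> xs j) - A) \<theta>))" for s
    using centered_char[of "s *\<^sub>R \<theta>"] by (simp add: X_def quad_form_scaleR)
qed

end

section \<open>The large deviation principle\<close>

context unit_power_series
begin

text \<open>The indicator removes the points outside [-1, 1], where the defining series may diverge
  and continuity is unknown.\<close>

lemma iter_indicator_measurable:
  "(\<lambda>t. (1 - (k ^^ L) t) * indicator {-1..1} t) \<in> borel_measurable borel"
  using borel_measurable_continuous_on_indicator[of "{-1..1}" "\<lambda>t. 1 - (k ^^ L) t"] continuous_on_iter[of L]
  by (simp add: continuous_intros mult.commute)

lemma iter_weight_measurable:
  "(\<lambda>t. (1 - (k ^^ L) t) * weight n t * indicator {-1<..<1} t) \<in> borel_measurable borel"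
proof -
  have "(\<lambda>t. ((1 - (k ^^ L) t) * indicator {-1..1} t) * (weight n t * indicator {-1<..<1} t)) \<in> borel_measurable borel"
    by (intro borel_measurable_times iter_indicator_measurable) measurable
  also have "(\<lambda>t. ((1 - (k ^^ L) t) * indicator {-1..1} t) * (weight n t * indicator {-1<..<1} t)) =
      (\<lambda>t. (1 - (k ^^ L) t) * weight n t * indicator {-1<..<1} t)"
    by (auto simp: indicator_def)
  finally show ?thesis .
qed

text \<open>The integral formula is for nonnegative functions, whereas the iterates can be negative;
  hence the passage to 1 minus the iterate.\<close>

lemma iter_sphere_mean:
  fixes x :: "'a::euclidean_space"
  assumes dim: "DIM('a) \<ge> 2" and x: "x \<in> sphere 0 1"
  shows "(LINT y|sphere_prob. (k ^^ L) (x \<bullet> y)) =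
    1 - (LBINT t=-1..1. (1 - (k ^^ L) t) * weight DIM('a) t) / (LBINT t=-1..1. weight DIM('a) t)"
proof -
  interpret P: prob_space "sphere_prob :: 'a measure" by (rule prob_space_sphere_prob)
  have mem: "x \<bullet> y \<in> {-1..1}" if "y \<in> sphere 0 1" for y
    using Cauchy_Schwarz_ineq2[of x y] x that by (auto simp: abs_le_iff)
  define h where "h t = (1 - (k ^^ L) t) * indicator {-1..1} t" for t
  have h: "h \<in> borel_measurable borel" unfolding h_def by (rule iter_indicator_measurable)
  have h0: "h t \<ge> 0" for t
    using iter_mem[of t L] by (auto simp: h_def indicator_def)
  have cont: "continuous_on (sphere 0 1) (\<lambda>y. (k ^^ L) (x \<bullet> y))"
    using mem by (intro continuous_on_compose2[OF continuous_on_iter] continuous_intros) blast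
  have int: "integrable sphere_prob (\<lambda>y. (k ^^ L) (x \<bullet> y))"
  proof (rule P.integrable_const_bound[of _ 1])
    show "AE y in sphere_prob. norm ((k ^^ L) (x \<bullet> y)) \<le> 1"
    proof (rule AE_I2)
      fix y :: 'a assume "y \<in> space sphere_prob"
      then have "x \<bullet> y \<in> {-1..1}" using mem by (simp add: space_sphere_prob)
      then show "norm ((k ^^ L) (x \<bullet> y)) \<le> 1" using abs_iter_le[of "x \<bullet> y" L] by (auto simp: abs_le_iff)
    qed
  qed (rule continuous_on_sphere_measurable[OF cont])
  have "(LINT y|sphere_prob. h (x \<bullet> y)) = (LINT y|sphere_prob. 1 - (k ^^ L) (x \<bullet> y))"
    using mem by (intro Bochner_Integration.integral_cong) (auto simp: h_def space_sphere_prob)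
  also have "\<dots> = 1 - (LINT y|sphere_prob. (k ^^ L) (x \<bullet> y))"
    using int by (simp add: P.prob_space)
  finally have "(LINT y|sphere_prob. (k ^^ L) (x \<bullet> y)) = 1 - (LINT y|sphere_prob. h (x \<bullet> y))" by simp
  also have "(LINT y|sphere_prob. h (x \<bullet> y)) =
      (LBINT t=-1..1. h t * weight DIM('a) t) / (LBINT t=-1..1. weight DIM('a) t)"
    by (rule integral_sphere_prob_inner[OF dim x h h0])
  also have "(LBINT t=-1..1. h t * weight DIM('a) t) = (LBINT t=-1..1. (1 - (k ^^ L) t) * weight DIM('a) t)"
    unfolding interval_integral_eq_LINT
    by (intro Bochner_Integration.integral_cong) (auto simp: h_def indicator_def)
  finally show ?thesis .
qed

lemma rescaled_weight_integral_tendsto: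
  assumes w: "integrable lborel (\<lambda>t. weight n t * indicator {-1<..<1} t)"
    and crit: "k1 = 1 \<longrightarrow> c \<noteq> 0 \<and> \<rho> > 1 \<and>
       (\<lambda>t. (1 - k t) - (k1 * (1 - t) - c * (1 - t) powr \<rho>)) \<in> o[at_left 1](\<lambda>t. (1 - t) powr \<rho>)"
    and g: "\<And>t. t \<in> {-1..1} \<Longrightarrow> (\<lambda>L. speed k1 \<rho> L * (1 - (k ^^ L) t)) \<longlonglongrightarrow> g t"
  shows "(\<lambda>L. speed k1 \<rho> L * (LBINT t=-1..1. (1 - (k ^^ L) t) * weight n t)) \<longlonglongrightarrow>
    (LBINT t=-1..1. g t * weight n t)"
proof -
  obtain C N where C: "\<And>L t. L \<ge> N \<Longrightarrow> t \<in> {-1..1} \<Longrightarrow> speed k1 \<rho> L * (1 - (k ^^ L) t) \<le> C"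
    using rescaled_iter_bounded[OF crit] by blast
  define f where "f L t = speed k1 \<rho> L * ((1 - (k ^^ L) t) * weight n t * indicator {-1<..<1} t)" for L t
  have fm: "f L \<in> borel_measurable borel" for L
    unfolding f_def by (intro borel_measurable_times iter_weight_measurable) simp
  have flim: "(\<lambda>L. f L t) \<longlonglongrightarrow> g t * weight n t * indicator {-1<..<1} t" for t
  proof (cases "t \<in> {-1<..<1}")
    case True
    then have "(\<lambda>L. speed k1 \<rho> L * (1 - (k ^^ L) t) * weight n t) \<longlonglongrightarrow> g t * weight n t"
      by (intro tendsto_mult tendsto_const g) auto
    then show ?thesis using True by (simp add: f_def mult.assoc)
  qed (simp add: f_def)
  \<comment> \<open>The limit function inherits measurability on the open interval from the
    iterates.\<close>
  have gm: "(\<lambda>t. g t * weight n t * indicator {-1<..<1} t) \<in> borel_measurable borel"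
    by (rule borel_measurable_LIMSEQ_real[OF flim fm])
  have "(\<lambda>L. LINT t|lborel. f (L + N) t) \<longlonglongrightarrow> (LINT t|lborel. g t * weight n t * indicator {-1<..<1} t)"
  proof (rule integral_dominated_convergence[where w = "\<lambda>t. C * (weight n t * indicator {-1<..<1} t)"])
    show "integrable lborel (\<lambda>t. C * (weight n t * indicator {-1<..<1} t))"
      using w by (rule integrable_mult_right)
    show "AE t in lborel. (\<lambda>L. f (L + N) t) \<longlonglongrightarrow> g t * weight n t * indicator {-1<..<1} t"
      using flim by (intro AE_I2 LIMSEQ_ignore_initial_segment)
    show "AE t in lborel. norm (f (L + N) t) \<le> C * (weight n t * indicator {-1<..<1} t)" for L
    proof (rule AE_I2)
      fix t
      show "norm (f (L + N) t) \<le> C * (weight n t * indicator {-1<..<1} t)"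
      proof (cases "t \<in> {-1<..<1}")
        case True
        then have t: "t \<in> {-1..1}" by auto
        have "0 \<le> speed k1 \<rho> (L + N) * (1 - (k ^^ (L + N)) t)"
          using speed_nonneg iter_mem[OF t, of "L + N"] by auto
        moreover have "speed k1 \<rho> (L + N) * (1 - (k ^^ (L + N)) t) \<le> C"
          by (rule C[OF _ t]) simp
        moreover have "f (L + N) t = (speed k1 \<rho> (L + N) * (1 - (k ^^ (L + N)) t)) * weight n t"
          using True by (simp add: f_def)
        ultimately show ?thesis using True by (simp add: abs_mult mult_right_mono)
      qed (simp add: f_def)
    qed
  qed (use fm gm in auto)
  then have "(\<lambda>L. LINT t|lborel. f L t) \<longlonglongrightarrow> (LINT t|lborel. g t * weight n t * indicator {-1<..<1} t)"
    by (rule LIMSEQ_offset)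
  then show ?thesis by (simp add: f_def interval_integral_eq_LINT)
qed

end

theorem theorem3p4:
  fixes J :: "nat \<Rightarrow> real"
    and k1 c \<rho> :: real
    and M :: "nat \<Rightarrow> 'w measure"
    and T :: "nat \<Rightarrow> 'w \<Rightarrow> 'a::euclidean_space \<Rightarrow> real"
    and xs :: "'m::finite \<Rightarrow> 'a"
  assumes dim: "DIM('a) \<ge> 2"
    and J_inf: "infinite {q. J q \<noteq> 0}"
    and J_sum: "summable (\<lambda>q. \<bar>J (Suc q)\<bar> / fact q)"
    and kappa1: "(\<lambda>q. (J q)\<^sup>2 / fact q) sums 1"
    and deriv1: "(kappa J has_real_derivative k1) (at_left 1)"
    and k1_le: "k1 \<le> 1"
    and crit: "k1 = 1 \<longrightarrow> c \<noteq> 0 \<and> \<rho> > 1 \<and>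
       (\<lambda>t. (1 - kappa J t) - (k1 * (1 - t) - c * (1 - t) powr \<rho>)) \<in> o[at_left 1](\<lambda>t. (1 - t) powr \<rho>)"
    and prob: "\<And>L. L \<ge> 1 \<Longrightarrow> prob_space (M L)"
    and cont: "\<And>L \<omega>. L \<ge> 1 \<Longrightarrow> \<omega> \<in> space (M L) \<Longrightarrow> continuous_on (sphere 0 1) (T L \<omega>)"
    and gauss: "\<And>L. L \<ge> 1 \<Longrightarrow>
       centered_gaussian_field (M L) (sphere 0 1) (T L) (\<lambda>x y. (kappa J ^^ L) (x \<bullet> y))"
    and xs_sphere: "\<And>i. xs i \<in> sphere 0 1"
    and xs_inj: "inj xs"
  shows "good_rate_function (rate2 (Bmat (real (DIM('a) - 1)) (glim J k1 \<rho>) xs)) \<and>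
         LDP M (\<lambda>L \<omega>. \<chi> i. T L \<omega> (xs i) - sphere_avg (T L \<omega>)) (speed k1 \<rho>)
           (rate2 (Bmat (real (DIM('a) - 1)) (glim J k1 \<rho>) xs))"
proof -
  interpret K: unit_power_series "\<lambda>q. (J q)\<^sup>2 / fact q" "kappa J" k1
    by (rule unit_power_series_kappa[OF J_inf kappa1 deriv1 k1_le])
  define W where "W = (LBINT t=-1..1. weight DIM('a) t)"
  define R where "R L = (LBINT t=-1..1. (1 - (kappa J ^^ L) t) * weight DIM('a) t) / W" for L
  have mean: "(LINT y|sphere_prob. (kappa J ^^ L) (x \<bullet> y)) = 1 - R L" if "x \<in> sphere 0 1" for x :: 'a and L
    unfolding R_def W_def by (rule K.iter_sphere_mean[OF dim that])
  \<comment> \<open>\<open>glim\<close> is defined by \<open>lim\<close>, which is a genuine limit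
    only once convergence is known.\<close>
  have glim: "(\<lambda>L. speed k1 \<rho> L * (1 - (kappa J ^^ L) t)) \<longlonglongrightarrow> glim J k1 \<rho> t" if "t \<in> {-1..1}" for t
    using K.rescaled_iter_convergent[OF that crit] unfolding glim_def convergent_LIMSEQ_iff .
  have "gaussian_sequence M (\<lambda>L \<omega>. \<chi> i. T L \<omega> (xs i) - sphere_avg (T L \<omega>))
      (\<lambda>L i j. (kappa J ^^ L) (xs i \<bullet> xs j) - (1 - R L)) (speed k1 \<rho>)
      (Bmat (real (DIM('a) - 1)) (glim J k1 \<rho>) xs)"
  proof (rule gaussian_sequence.intro)
    fix L :: nat assume L: "L \<ge> 1"
    show "prob_space (M L)" by (rule prob[OF L])
    show "(\<lambda>\<omega>. \<chi> i. T L \<omega> (xs i) - sphere_avg (T L \<omega>)) \<in> borel_measurable (M L)"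
      by (rule centered_measurable[OF prob[OF L] cont[OF L] gauss[OF L] K.continuous_on_iter mean xs_sphere])
    fix \<theta> :: "real^'m"
    have *: "integrable (M L) (\<lambda>\<omega>. exp (\<theta> \<bullet> (\<chi> i. T L \<omega> (xs i) - sphere_avg (T L \<omega>)))) \<and>
        (LINT \<omega>|M L. exp (\<theta> \<bullet> (\<chi> i. T L \<omega> (xs i) - sphere_avg (T L \<omega>)))) =
          exp (1/2 * quad_form (\<lambda>i j. (kappa J ^^ L) (xs i \<bullet> xs j) - (1 - R L)) \<theta>)"
      by (rule centered_mgf[OF prob[OF L] cont[OF L] gauss[OF L] K.continuous_on_iter mean xs_sphere])
    show "integrable (M L) (\<lambda>\<omega>. exp (\<theta> \<bullet> (\<chi> i. T L \<omega> (xs i) - sphere_avg (T L \<omega>))))"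
      using * by blast
    show "(LINT \<omega>|M L. exp (\<theta> \<bullet> (\<chi> i. T L \<omega> (xs i) - sphere_avg (T L \<omega>)))) =
        exp (1/2 * quad_form (\<lambda>i j. (kappa J ^^ L) (xs i \<bullet> xs j) - (1 - R L)) \<theta>)"
      using * by blast
  next
    show "(kappa J ^^ L) (xs i \<bullet> xs j) - (1 - R L) = (kappa J ^^ L) (xs j \<bullet> xs i) - (1 - R L)" for L i j
      by (simp add: inner_commute)
    show "filterlim (speed k1 \<rho>) at_top sequentially"
      using crit by (intro K.speed_at_top) blast
    fix i j
    have mem: "xs i \<bullet> xs j \<in> {-1..1}"
      using Cauchy_Schwarz_ineq2[of "xs i" "xs j"] xs_sphere[of i] xs_sphere[of j] by (auto simp: abs_le_iff)
    have "(\<lambda>L. speed k1 \<rho> L * (LBINT t=-1..1. (1 - (kappa J ^^ L) t) * weight DIM('a) t)) \<longlonglongrightarrow>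
        (LBINT t=-1..1. glim J k1 \<rho> t * weight DIM('a) t)"
      by (rule K.rescaled_weight_integral_tendsto[OF integrable_weight[OF dim] crit glim])
    from tendsto_mult_right[OF this, of "inverse W"]
    have "(\<lambda>L. speed k1 \<rho> L * R L) \<longlonglongrightarrow> (LBINT t=-1..1. glim J k1 \<rho> t * weight DIM('a) t) / W"
      by (simp only: R_def divide_inverse mult.assoc)
    \<comment> \<open>The entry is regrouped as \<open>R L\<close> minus the deviation of the
      iterate from 1: these rescaled terms converge separately, while the rescaled iterate itself
      diverges.\<close>
    from tendsto_diff[OF this glim[OF mem]]
    show "(\<lambda>L. speed k1 \<rho> L * ((kappa J ^^ L) (xs i \<bullet> xs j) - (1 - R L))) \<longlonglongrightarrow>
        Bmat (real (DIM('a) - 1)) (glim J k1 \<rho>) xs i j"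
      by (simp add: Bmat_def W_def algebra_simps)
  qed
  then show ?thesis
    using good_rate_function_rate2 gaussian_sequence.LDP_rate2 by blast
qed

end
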